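(* Let $K$ be an algebraic number field. Then $K$ has the maximal linear matching property, i.e. for every positive integer $n$ there exists a field extension $L_n$ of $K$ such that $[L_n:K]=n$ and $L_n$ has the linear matching property from $K$.
   Context: Standing convention: field extensions $K\subset L$ are considered where $K$ is commutative and central in $L$. Matched bases: Let $K\subset L$ be a field extension and let $A,B$ be $n$-dimensional $K$-subspaces of $L$. Let $\mathcal A=\{a_1,\ldots,a_n\}$ and $\mathcal B=\{b_1,\ldots,b_n\}$ be bases of $A$ and $B$ respectively. The basis $\mathcal A$ is matched to $\mathcal B$ if for all $b\in B$ and all $i=1,\ldots,n$, $$a_i b\in A \ \Rightarrow\ b\in\langle b_1,\ldots,\hat{b_i},\ldots,b_n\rangle,$$ where $\langle b_1,\ldots,\hat{b_i},\ldots,b_n\rangle$ is the hyperplane of $B$ spanned over $K$ by $\mathcal B\setminus\{b_i\}$. Matched subspaces: $A$ is matched to $B$ if every basis of $A$ can be matched to some basis of $B$. Linear matching property: $L$ has the linear matching property from $K$ if, for every $m\geq 1$ and all $m$-dimensional $K$-subspaces $A$ and $B$ of $L$ with $1\notin B$, the subspace $A$ is matched to $B$. Maximal linear matching property: a field $K$ has the maximal linear matching property if for every positive integer $n$ there exists a field extension $L_n$ of $K$ such that $[L_n:K]=n$ and $L_n$ has the linear matching property from $K$. *)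

theory Defs
  imports "HOL-Algebra.Algebra"
begin

section \<open>Field extensions\<close>

locale division_ring = ring +
  assumes one_not_zero: "\<one> \<noteq> \<zero>"
    and units_eq: "Units R = carrier R - {\<zero>}"

text \<open>
  A field extension is given by a ring homomorphism \<open>h\<close> from a commutative field \<open>K\<close> into
  the centre of a possibly noncommutative division ring \<open>L\<close>. Such an \<open>h\<close> is injective,
  and \<open>K\<close> is identified with the subfield \<open>h ` carrier K\<close> of \<open>L\<close>.
\<close>

definition field_extension ::
    "('a, 'm) ring_scheme \<Rightarrow> ('b, 'n) ring_scheme \<Rightarrow> ('a \<Rightarrow> 'b) \<Rightarrow> bool" where
  "field_extension K L h \<longleftrightarrow>
     field K \<and> division_ring L \<and> h \<in> ring_hom K L \<and>
     (\<forall>k \<in> carrier K. \<forall>x \<in> carrier L. h k \<otimes>\<^bsub>L\<^esub> x = x \<otimes>\<^bsub>L\<^esub> h k)"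

definition has_degree ::
    "('a, 'm) ring_scheme \<Rightarrow> ('b, 'n) ring_scheme \<Rightarrow> ('a \<Rightarrow> 'b) \<Rightarrow> nat \<Rightarrow> bool" where
  "has_degree K L h n \<longleftrightarrow> ring.dimension L n (h ` carrier K) (carrier L)"

abbreviation rat_ring :: "rat ring" where
  "rat_ring \<equiv> \<lparr>carrier = UNIV, monoid.mult = (*), one = 1, ring.zero = 0, add = (+)\<rparr>"

definition algebraic_number_field :: "('a, 'm) ring_scheme \<Rightarrow> bool" where
  "algebraic_number_field K \<longleftrightarrow>
     field K \<and> (\<exists>h n. field_extension rat_ring K h \<and> has_degree rat_ring K h n)"


section \<open>Linear matchings\<close>

context ring
begin

text \<open>
  Here \<open>K\<close> is a central subfield of the ambient ring. Bases are ordered, hence lists;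
  \<open>dimension n K A\<close> entails that \<open>A\<close> is a \<open>K\<close>-subspace of the ambient ring.
\<close>

definition is_basis :: "'a set \<Rightarrow> 'a set \<Rightarrow> 'a list \<Rightarrow> bool" where
  "is_basis K A as \<longleftrightarrow> independent K as \<and> Span K as = A"

definition matched_bases :: "'a set \<Rightarrow> 'a set \<Rightarrow> 'a set \<Rightarrow> 'a list \<Rightarrow> 'a list \<Rightarrow> bool" where
  "matched_bases K A B as bs \<longleftrightarrow>
     (\<forall>b \<in> B. \<forall>i < length as.
        as ! i \<otimes> b \<in> A \<longrightarrow> b \<in> Span K (take i bs @ drop (Suc i) bs))"

definition matched_subspaces :: "'a set \<Rightarrow> 'a set \<Rightarrow> 'a set \<Rightarrow> bool" where
  "matched_subspaces K A B \<longleftrightarrow>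
     (\<forall>as. is_basis K A as \<longrightarrow> (\<exists>bs. is_basis K B bs \<and> matched_bases K A B as bs))"

definition linear_matching_property :: "'a set \<Rightarrow> bool" where
  "linear_matching_property K \<longleftrightarrow>
     (\<forall>m \<ge> 1. \<forall>A B. dimension m K A \<and> dimension m K B \<and> \<one> \<notin> B \<longrightarrow> matched_subspaces K A B)"

end

text \<open>
  HOL cannot quantify existentially over the type of \<open>L\<close>, so a type is fixed. It loses no
  generality: choosing a \<open>K\<close>-basis of an extension of degree \<open>n\<close> identifies its elements
  with their coordinate lists \<open>xs :: 'a list\<close> of length \<open>n\<close>, and so with the singletons
  \<open>{xs}\<close>; transporting the structure yields an isomorphic extension of the type below.
  This type is also that of the quotients of the polynomial ring \<open>K[X]\<close>.
\<close>

definition maximal_linear_matching_property :: "('a, 'm) ring_scheme \<Rightarrow> bool" where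
  "maximal_linear_matching_property K \<longleftrightarrow>
     (\<forall>n \<ge> 1. \<exists>(L :: 'a list set ring) h.
        field_extension K L h \<and> has_degree K L h n \<and>
        ring.linear_matching_property L (h ` carrier K))"

end

theory Submission
  imports Defs "HOL-Algebra.Algebraic_Closure_Type"
begin

text \<open>
  A finite extension \<open>L\<close> of \<open>K\<close> without proper intermediate fields has the linear matching property:
  the subspaces of \<open>L\<close> then satisfy the linear Cauchy-Davenport inequality
  \<open>dim S + dim T - 1 \<le> dim (S T)\<close> unless \<open>S T\<close> spans \<open>L\<close>. Applied to the span \<open>S\<close> of the basis vectors
  \<open>a\<^sub>i\<close>, \<open>i \<in> J\<close>, and to \<open>T = K + \<Inter>\<^sub>i V\<^sub>i\<close>, where \<open>V\<^sub>i = {b \<in> B. a\<^sub>i b \<in> A}\<close>, it gives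
  \<open>dim (\<Inter>\<^sub>i V\<^sub>i) \<le> dim B - |J|\<close>. This is Rado's condition for the existence of independent hyperplanes
  containing the \<open>V\<^sub>i\<close>, and the basis of \<open>B\<close> dual to them is matched to the given basis.

  For \<open>n \<ge> 2\<close>, such an \<open>L\<close> is generated by a root \<open>\<alpha>\<close> of \<open>x\<^sup>n + 4 x\<^sup>n\<^sup>-\<^sup>1 + b\<close>, where \<open>b \<in> K\<close> is a uniformizer
  for a valuation above \<open>2\<close> and for one above \<open>3\<close>. Above \<open>2\<close>, the value of \<open>\<alpha>\<close> has order \<open>n\<close> modulo the values
  of \<open>K\<close>, so that \<open>[L : K] = n\<close>. Above \<open>3\<close>, some root has a value of order \<open>n - 1\<close>. This order divides \<open>s t\<close>
  with \<open>s \<le> [L : M]\<close> and \<open>t \<le> [M : K]\<close> for every intermediate field \<open>M\<close>, which forces \<open>M\<close> to be \<open>K\<close> or \<open>L\<close>.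
  Everything takes place inside the complex numbers, so that a valuation ring of \<open>\<complex>\<close> induces compatible
  valuations on all the fields involved.
\<close>

section \<open>Linear matchings without intermediate fields\<close>

context ring
begin

text \<open>Codimension one is stated with \<open>Suc h\<close> instead of a subtraction, so the
  zero space has no hyperplane.\<close>

definition hyperplane :: "'a set \<Rightarrow> 'a set \<Rightarrow> 'a set \<Rightarrow> bool" where
  "hyperplane K B H \<longleftrightarrow> H \<subseteq> B \<and> (\<exists>h. dimension h K H \<and> dimension (Suc h) K B)"

context
  fixes K :: "'a set"
  assumes K: "subfield K R"
begin

section \<open>Subspaces, dimensions and independent lists over a subfield\<close>

lemma subspaceI:
  assumes "E \<subseteq> carrier R" "\<zero> \<in> E"
    and "\<And>x y. x \<in> E \<Longrightarrow> y \<in> E \<Longrightarrow> x \<oplus> y \<in> E"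
    and "\<And>k x. k \<in> K \<Longrightarrow> x \<in> E \<Longrightarrow> k \<otimes> x \<in> E"
  shows "subalgebra K E R"
proof -
  have "\<ominus> \<one> \<in> K"
    using subringE(3,5)[OF subfieldE(1)[OF K]] by blast
  have minus: "\<ominus> x \<in> E" if "x \<in> E" for x
  proof -
    have "x \<in> carrier R" using that assms(1) by blast
    hence "\<ominus> x = \<ominus> \<one> \<otimes> x"
      using l_minus[OF one_closed] by simp
    thus ?thesis
      using assms(4)[OF \<open>\<ominus> \<one> \<in> K\<close> that] by simp
  qed
  have "subgroup E (add_monoid R)"
    using assms(2) minus by (intro add.subgroupI assms(1,3)) (auto simp: a_inv_def)
  thus ?thesis
    unfolding subalgebra_def subalgebra_axioms_def using assms(4) by auto
qed

lemma subspaceD: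
  assumes "subalgebra K E R"
  shows "E \<subseteq> carrier R" "\<zero> \<in> E"
    and "\<And>x y. x \<in> E \<Longrightarrow> y \<in> E \<Longrightarrow> x \<oplus> y \<in> E"
    and "\<And>k x. k \<in> K \<Longrightarrow> x \<in> E \<Longrightarrow> k \<otimes> x \<in> E"
  using subalgebra_in_carrier[OF assms] subalgebra.smult_closed[OF assms]
    subgroup.one_closed[OF subalgebra.axioms(1)[OF assms]]
    subgroup.m_closed[OF subalgebra.axioms(1)[OF assms]] by auto

lemma dimension_subspace:
  "dimension n K E \<Longrightarrow> subalgebra K E R"
  using finite_dimension_imp_subalgebra[OF K finite_dimensionI] .

lemma subspace_dimension:
  assumes "dimension n K E" "subalgebra K V R" "V \<subseteq> E"
  shows "\<exists>m. dimension m K V"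
  using subalbegra_incl_imp_finite_dimension[OF K finite_dimensionI[OF assms(1)] assms(2,3)]
  unfolding finite_dimension_def by auto

lemma dimension_mono:
  assumes "dimension m K V" "dimension n K E" "V \<subseteq> E"
  shows "m \<le> n"
proof -
  obtain Vs where "independent K Vs" "length Vs = m" "Span K Vs = V" "set Vs \<subseteq> carrier R"
    using exists_base[OF K assms(1)] by auto
  thus ?thesis
    using independent_length_le_dimension[OF K assms(2), of Vs] Span_base_incl[OF K, of Vs] assms(3)
    by auto
qed

lemma dimension_eq_imp_eq:
  assumes "dimension n K V" "dimension n K E" "V \<subseteq> E"
  shows "V = E"
proof -
  obtain Vs where "independent K Vs" "length Vs = n" "Span K Vs = V" "set Vs \<subseteq> carrier R"
    using exists_base[OF K assms(1)] by auto
  thus ?thesis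
    using independent_length_eq_dimension[OF K assms(2), of Vs] Span_base_incl[OF K, of Vs] assms(3)
    by auto
qed

lemma independent_subset:
  assumes "independent K Us" "set Vs \<subseteq> set Us" "distinct Vs"
  shows "independent K Vs"
proof -
  \<comment> \<open>Independence is defined along a list, so the vectors are first reordered to make
    \<open>Vs\<close> an initial segment.\<close>
  obtain Ws where Ws: "set Ws = set Us - set Vs" "distinct Ws"
    using finite_distinct_list[of "set Us - set Vs"] by auto
  have "distinct (Vs @ Ws)" "set (Vs @ Ws) = set Us"
    using Ws assms(2,3) by auto
  moreover have "distinct Us"
    using independent_distinct[OF K assms(1)] .
  ultimately have "independent K (Vs @ Ws)"
    using independent_same_set[OF K, of Us "Vs @ Ws"] assms(1) by (metis distinct_card)
  thus ?thesis
    using independent_split(2)[OF K] by blast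
qed

section \<open>Hyperplanes and their transversals\<close>

text \<open>The sum of \<open>U\<close> and \<open>H\<close> stays inside \<open>B\<close>, whose
  dimension exceeds that of \<open>H\<close> by one only; the dimension formula for sums does the
  rest.\<close>

lemma subspace_inter_hyperplane:
  assumes "hyperplane K B H" "dimension u K U" "U \<subseteq> B" "dimension k K (U \<inter> H)"
  shows "u \<le> Suc k"
proof -
  obtain h where h: "dimension h K H" "dimension (Suc h) K B" and "H \<subseteq> B"
    using assms(1) unfolding hyperplane_def by auto
  have "subalgebra K B R"
    using dimension_subspace[OF h(2)] .
  hence "U <+>\<^bsub>R\<^esub> H \<subseteq> B"
    using assms(3) \<open>H \<subseteq> B\<close> subspaceD(3) unfolding set_add_def' by blast
  moreover have "dimension (u + h - k) K (U <+>\<^bsub>R\<^esub> H)"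
    using dimension_sum_space[OF K assms(2) h(1) assms(4)] .
  ultimately have "u + h - k \<le> Suc h"
    using dimension_mono h(2) by blast
  thus ?thesis by linarith
qed

text \<open>A basis of \<open>V\<close>, enlarged by \<open>u\<close>, extends to a basis of
  \<open>B\<close>; all vectors of this basis except \<open>u\<close> span the hyperplane.\<close>

lemma separating_hyperplane:
  assumes B: "dimension n K B" and "subalgebra K V R" "V \<subseteq> B" "u \<in> B" "u \<notin> V"
  obtains H where "hyperplane K B H" "V \<subseteq> H" "u \<notin> H"
proof -
  obtain v where "dimension v K V"
    using subspace_dimension[OF B assms(2,3)] by auto
  then obtain Vs where Vs: "independent K Vs" "Span K Vs = V" "set Vs \<subseteq> carrier R"
    using exists_base[OF K] by blast
  have carr: "u \<in> carrier R"
    using subspaceD(1)[OF dimension_subspace[OF B]] assms(4) by auto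
  have "independent K (u # Vs)"
    using Vs carr assms(5) li_Cons by auto
  moreover have "set (u # Vs) \<subseteq> B"
    using Span_base_incl[OF K Vs(3)] Vs(2) assms(3,4) by auto
  ultimately obtain Ws where Ws: "length (Ws @ u # Vs) = n" "independent K (Ws @ u # Vs)"
      "Span K (Ws @ u # Vs) = B"
    using complete_base[OF K B] by metis
  have ind: "independent K (u # (Ws @ Vs))"
    using independent_same_set[OF K _ _ Ws(2), of "u # (Ws @ Vs)"] by auto
  hence ind': "independent K (Ws @ Vs)" and u: "u \<notin> Span K (Ws @ Vs)"
    using independent_backwards by blast+
  have carrW: "set (Ws @ u # Vs) \<subseteq> carrier R"
    using independent_in_carrier[OF Ws(2)] .
  show thesis
  proof (rule that)
    have "Span K (Ws @ Vs) \<subseteq> B"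
      using mono_Span_sublist[OF K _ carrW, of "Ws @ Vs"] Ws(3) by auto
    moreover have "length (Ws @ u # Vs) = Suc (length (Ws @ Vs))"
      by simp
    ultimately show "hyperplane K B (Span K (Ws @ Vs))"
      unfolding hyperplane_def using dimension_independent[OF ind'] B Ws(1) by metis
    show "V \<subseteq> Span K (Ws @ Vs)"
      using mono_Span_append(2)[OF K Vs(3), of Ws] carrW Vs(2) by auto
    show "u \<notin> Span K (Ws @ Vs)"
      by (rule u)
  qed
qed

lemma subspace_Inter:
  assumes "subalgebra K U R" "\<And>i. i \<in> J \<Longrightarrow> subalgebra K (V i) R"
  shows "subalgebra K {x \<in> U. \<forall>i\<in>J. x \<in> V i} R"
proof (rule subspaceI)
  show "{x \<in> U. \<forall>i\<in>J. x \<in> V i} \<subseteq> carrier R"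
    using subspaceD(1)[OF assms(1)] by auto
  show "\<zero> \<in> {x \<in> U. \<forall>i\<in>J. x \<in> V i}"
    by (auto intro: subspaceD(2)[OF assms(1)] subspaceD(2)[OF assms(2)])
  show "x \<oplus> y \<in> {x \<in> U. \<forall>i\<in>J. x \<in> V i}"
    if "x \<in> {x \<in> U. \<forall>i\<in>J. x \<in> V i}" "y \<in> {x \<in> U. \<forall>i\<in>J. x \<in> V i}" for x y
    using that by (auto intro: subspaceD(3)[OF assms(1)] subspaceD(3)[OF assms(2)])
  show "k \<otimes> x \<in> {x \<in> U. \<forall>i\<in>J. x \<in> V i}"
    if "k \<in> K" "x \<in> {x \<in> U. \<forall>i\<in>J. x \<in> V i}" for k x
    using that by (auto intro: subspaceD(4)[OF assms(1)] subspaceD(4)[OF assms(2)])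
qed

text \<open>
  The dual form of Rado's theorem on independent transversals, relative to a subspace \<open>U\<close>. As for
  Hall's theorem, one distinguishes whether some proper subfamily satisfies its condition with equality.
\<close>

lemma hyperplane_transversal:
  fixes V :: "nat \<Rightarrow> 'a set"
  assumes B: "dimension n K B" and "finite I"
    and "\<And>i. i \<in> I \<Longrightarrow> subalgebra K (V i) R" "\<And>i. i \<in> I \<Longrightarrow> V i \<subseteq> B"
    and "dimension u K U" "U \<subseteq> B"
    and "\<And>J k. J \<subseteq> I \<Longrightarrow> dimension k K {x \<in> U. \<forall>i\<in>J. x \<in> V i} \<Longrightarrow> k + card J \<le> u"
  shows "\<exists>H. (\<forall>i\<in>I. V i \<subseteq> H i \<and> hyperplane K B (H i)) \<and>
             (\<exists>k. dimension k K {x \<in> U. \<forall>i\<in>I. x \<in> H i} \<and> k + card I = u)"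
  using assms(2-)
proof (induction "card I" arbitrary: I U u rule: less_induct)
  case less
  note I = \<open>finite I\<close> and V = less.prems(2,3) and U = less.prems(4,5) and rank = less.prems(6)
  have Usub: "subalgebra K U R"
    using dimension_subspace[OF U(1)] .
  have dimW: "\<exists>k. dimension k K {x \<in> U. \<forall>i\<in>J. x \<in> V i}" if "J \<subseteq> I" for J
  proof -
    have "subalgebra K {x \<in> U. \<forall>i\<in>J. x \<in> V i} R"
      by (rule subspace_Inter[OF Usub]) (use that V(1) in auto)
    thus ?thesis
      by (rule subspace_dimension[OF U(1)]) auto
  qed
  show ?case
  proof (cases "I = {}")
    case True
    thus ?thesis using U by auto
  next
    case ne: False
    show ?thesis
    proof (cases "\<exists>J k. J \<noteq> {} \<and> J \<subset> I \<and> dimension k K {x \<in> U. \<forall>i\<in>J. x \<in> V i} \<and> k + card J = u")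
      case True
      \<comment> \<open>A proper nonempty subfamily \<open>J\<close> is tight: it is treated first,
        inside \<open>U\<close>, and \<open>I - J\<close> afterwards, inside the intersection that
        \<open>J\<close> cuts out of \<open>U\<close>.\<close>
      then obtain J k where J: "J \<noteq> {}" "J \<subset> I"
        and k: "dimension k K {x \<in> U. \<forall>i\<in>J. x \<in> V i}" "k + card J = u"
        by blast
      have finJ: "finite J" "finite (I - J)"
        using I J(2) finite_subset[of J I] by auto
      have card: "card J < card I" "card (I - J) < card I"
        using J psubset_card_mono[OF I, of J] psubset_card_mono[OF I, of "I - J"] by auto
      have "\<exists>H. (\<forall>i\<in>J. V i \<subseteq> H i \<and> hyperplane K B (H i)) \<and>
             (\<exists>k. dimension k K {x \<in> U. \<forall>i\<in>J. x \<in> H i} \<and> k + card J = u)"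
      proof (rule less.hyps[OF card(1) finJ(1) _ _ U])
        show "subalgebra K (V i) R" "V i \<subseteq> B" if "i \<in> J" for i
          using V[of i] J(2) that by auto
        show "k + card J' \<le> u" if "J' \<subseteq> J" "dimension k K {x \<in> U. \<forall>i\<in>J'. x \<in> V i}" for J' k
          using rank[OF _ that(2)] that(1) J(2) by auto
      qed
      then obtain H k' where H: "\<forall>i\<in>J. V i \<subseteq> H i \<and> hyperplane K B (H i)"
        and k': "dimension k' K {x \<in> U. \<forall>i\<in>J. x \<in> H i}" "k' + card J = u"
        by blast
      have "k' = k" using k(2) k'(2) by simp
      \<comment> \<open>Tightness forces equality: the \<open>H i\<close> contain the
        \<open>V i\<close>, and both families cut out spaces of dimension \<open>k\<close>.\<close>
      hence eq: "{x \<in> U. \<forall>i\<in>J. x \<in> V i} = {x \<in> U. \<forall>i\<in>J. x \<in> H i}" (is "?U' = _")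
        using H k'(1) by (intro dimension_eq_imp_eq[OF k(1)]) auto
      have "\<exists>H. (\<forall>i\<in>I-J. V i \<subseteq> H i \<and> hyperplane K B (H i)) \<and>
             (\<exists>l. dimension l K {x \<in> ?U'. \<forall>i\<in>I-J. x \<in> H i} \<and> l + card (I-J) = k)"
      proof (rule less.hyps[OF card(2) finJ(2) _ _ k(1)])
        fix J' l assume J': "J' \<subseteq> I - J" and l: "dimension l K {x \<in> ?U'. \<forall>i\<in>J'. x \<in> V i}"
        \<comment> \<open>The condition for \<open>J'\<close> inside \<open>?U'\<close> is the one
          for the disjoint union of \<open>J\<close> and \<open>J'\<close> inside \<open>U\<close>,
          minus the equality for \<open>J\<close>.\<close>
        have "{x \<in> ?U'. \<forall>i\<in>J'. x \<in> V i} = {x \<in> U. \<forall>i\<in>J \<union> J'. x \<in> V i}"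
          by auto
        hence "dimension l K {x \<in> U. \<forall>i\<in>J \<union> J'. x \<in> V i}"
          using l by simp
        moreover have "J \<union> J' \<subseteq> I"
          using J(2) J' by auto
        ultimately have "l + card (J \<union> J') \<le> u"
          by (rule rank[rotated])
        moreover have "card (J \<union> J') = card J + card J'"
          using J' finJ by (intro card_Un_disjoint) (auto intro: finite_subset)
        ultimately show "l + card J' \<le> k"
          using k(2) by linarith
      next
        show "subalgebra K (V i) R" "V i \<subseteq> B" if "i \<in> I - J" for i
          using V[of i] that by auto
        show "?U' \<subseteq> B" using U(2) by auto
      qed
      then obtain H' l where H': "\<forall>i\<in>I-J. V i \<subseteq> H' i \<and> hyperplane K B (H' i)"
        and l: "dimension l K {x \<in> ?U'. \<forall>i\<in>I-J. x \<in> H' i}" "l + card (I-J) = k"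
        by blast
      let ?H = "\<lambda>i. if i \<in> J then H i else H' i"
      have "{x \<in> U. \<forall>i\<in>I. x \<in> ?H i} = {x \<in> ?U'. \<forall>i\<in>I-J. x \<in> H' i}"
        unfolding eq using J(2) by auto
      moreover have "l + card I = u"
        using l(2) k(2) card_Diff_subset[OF finJ(1), of I] J(2) I card(1) by auto
      ultimately have "dimension l K {x \<in> U. \<forall>i\<in>I. x \<in> ?H i} \<and> l + card I = u"
        using l(1) by simp
      moreover have "\<forall>i\<in>I. V i \<subseteq> ?H i \<and> hyperplane K B (?H i)"
        using H H' by simp
      ultimately show ?thesis
        by (intro exI[of _ ?H] conjI exI[of _ l]) auto
    next
      case False
      \<comment> \<open>No proper nonempty subfamily is tight. Hence any hyperplane containing
        \<open>V i\<close> but not \<open>U\<close> serves for \<open>i\<close>: when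
        \<open>U\<close> shrinks to \<open>U \<inter> H0\<close>, the other indices have one
        dimension to spare.\<close>
      obtain i where i: "i \<in> I" using ne by auto
      obtain k where "dimension k K {x \<in> U. \<forall>j\<in>{i}. x \<in> V j}"
        using dimW[of "{i}"] i by auto
      moreover from this have "k + 1 \<le> u"
        using rank[of "{i}" k] i by auto
      ultimately have "{x \<in> U. \<forall>j\<in>{i}. x \<in> V j} \<noteq> U"
        using dimension_is_inj[OF K _ U(1)] by fastforce
      then obtain x where x: "x \<in> U" "x \<notin> V i" by auto
      obtain H0 where H0: "hyperplane K B H0" "V i \<subseteq> H0" "x \<notin> H0"
        by (rule separating_hyperplane[OF B V(1)[OF i] V(2)[OF i], of x]) (use x U(2) in auto)
      hence "subalgebra K H0 R"
        unfolding hyperplane_def using dimension_subspace by auto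
      have sub: "subalgebra K (U \<inter> H0) R"
        using subalgebra_inter[OF Usub \<open>subalgebra K H0 R\<close>] .
      obtain u' where u': "dimension u' K (U \<inter> H0)"
        using subspace_dimension[OF U(1) sub] by auto
      have "u \<le> Suc u'"
        using subspace_inter_hyperplane[OF H0(1) U u'] .
      moreover have "u' \<le> u"
        using dimension_mono[OF u' U(1)] by auto
      moreover have "u' \<noteq> u"
        using dimension_eq_imp_eq[OF _ U(1), of "U \<inter> H0"] u' x(1) H0(3) by blast
      ultimately have uu': "Suc u' = u" by linarith
      have card: "card (I - {i}) < card I"
        using i I by (meson card_Diff1_less)
      have "\<exists>H. (\<forall>j\<in>I-{i}. V j \<subseteq> H j \<and> hyperplane K B (H j)) \<and>
             (\<exists>k. dimension k K {x \<in> U \<inter> H0. \<forall>j\<in>I-{i}. x \<in> H j} \<and> k + card (I-{i}) = u')"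
      proof (rule less.hyps[OF card _ _ _ u'])
        fix J k assume J: "J \<subseteq> I - {i}" and k: "dimension k K {x \<in> U \<inter> H0. \<forall>i\<in>J. x \<in> V i}"
        show "k + card J \<le> u'"
        proof (cases "J = {}")
          case True
          thus ?thesis
            using dimension_mono[OF k u'] by auto
        next
          case Jne: False
          have JI: "J \<subset> I" using J i by auto
          obtain l where l: "dimension l K {x \<in> U. \<forall>i\<in>J. x \<in> V i}"
            using dimW[of J] JI by auto
          have "l + card J \<le> u"
            using rank[OF _ l] JI by auto
          moreover have "l + card J \<noteq> u"
            using False Jne JI l by blast
          moreover have "k \<le> l"
            using dimension_mono[OF k l] by auto
          ultimately show ?thesis
            using uu' by linarith
        qed
      next
        show "subalgebra K (V j) R" "V j \<subseteq> B" if "j \<in> I - {i}" for j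
          using V[of j] that by auto
        show "U \<inter> H0 \<subseteq> B" "finite (I - {i})" using U(2) I by auto
      qed
      then obtain H k where H: "\<forall>j\<in>I-{i}. V j \<subseteq> H j \<and> hyperplane K B (H j)"
        and k: "dimension k K {x \<in> U \<inter> H0. \<forall>j\<in>I-{i}. x \<in> H j}" "k + card (I-{i}) = u'"
        by blast
      let ?H = "H(i := H0)"
      have "{x \<in> U. \<forall>j\<in>I. x \<in> ?H j} = {x \<in> U \<inter> H0. \<forall>j\<in>I-{i}. x \<in> H j}"
        using i by auto
      moreover have "k + card I = u"
        using k(2) uu' i I by (simp add: card_Diff_singleton) (metis Suc_pred add_Suc_right card_gt_0_iff empty_iff)
      ultimately have "dimension k K {x \<in> U. \<forall>j\<in>I. x \<in> ?H j} \<and> k + card I = u"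
        using k(1) by simp
      moreover have "\<forall>j\<in>I. V j \<subseteq> ?H j \<and> hyperplane K B (?H j)"
        using H H0 by simp
      ultimately show ?thesis
        by (intro exI[of _ ?H] conjI exI[of _ k]) auto
    qed
  qed
qed

text \<open>Each hyperplane lowers the dimension by at most one, so all of them but
  \<open>H i\<close> share a nonzero vector \<open>b i\<close>, which lies outside
  \<open>H i\<close> because the total intersection is zero. The \<open>n - 1\<close> vectors
  \<open>b j\<close> with j \<noteq> i are then a basis of \<open>H i\<close>.\<close>

lemma dual_basis_of_hyperplanes:
  fixes H :: "nat \<Rightarrow> 'a set"
  assumes B: "dimension n K B"
    and hyper: "\<And>i. i < n \<Longrightarrow> hyperplane K B (H i)"
    and trivial: "{x \<in> B. \<forall>i<n. x \<in> H i} = {\<zero>}"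
  obtains bs where "independent K bs" "Span K bs = B"
    "\<And>i. i < n \<Longrightarrow> Span K (take i bs @ drop (Suc i) bs) = H i"
proof -
  have Bsub: "subalgebra K B R"
    using dimension_subspace[OF B] .
  have H: "H i \<subseteq> B" "\<exists>h. dimension h K (H i) \<and> Suc h = n" if "i < n" for i
    using hyper[OF that] dimension_is_inj[OF K B] unfolding hyperplane_def by blast+
  have Hsub: "subalgebra K (H i) R" if "i < n" for i
    using H(2)[OF that] dimension_subspace by blast
  have bound: "\<exists>k. dimension k K {x \<in> B. \<forall>i\<in>J. x \<in> H i} \<and> n \<le> k + card J"
    if "finite J" "J \<subseteq> {..<n}" for J
    using that
  proof (induction J rule: finite_induct)
    case empty
    thus ?case using B by auto
  next
    case (insert i J)
    then obtain k where k: "dimension k K {x \<in> B. \<forall>i\<in>J. x \<in> H i}" "n \<le> k + card J"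
      by auto
    obtain h where h: "dimension h K (H i)" "Suc h = n"
      using H(2)[of i] insert.prems by auto
    let ?W = "{x \<in> B. \<forall>i\<in>J. x \<in> H i}"
    have eq: "?W \<inter> H i = {x \<in> B. \<forall>j\<in>insert i J. x \<in> H j}"
      by auto
    obtain l where l: "dimension l K (?W \<inter> H i)"
      using subspace_dimension[OF k(1) subalgebra_inter[OF dimension_subspace[OF k(1)] dimension_subspace[OF h(1)]]]
      by auto
    have "k \<le> Suc l"
      using subspace_inter_hyperplane[OF hyper k(1) _ l] insert.prems by auto
    thus ?case
      using l k(2) insert.hyps unfolding eq by (intro exI[of _ l]) auto
  qed
  have "\<exists>b. b \<in> B \<and> (\<forall>j<n. j \<noteq> i \<longrightarrow> b \<in> H j) \<and> b \<noteq> \<zero>" if i: "i < n" for i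
  proof (rule ccontr)
    assume neg: "\<not> ?thesis"
    obtain k where k: "dimension k K {x \<in> B. \<forall>j\<in>{..<n}-{i}. x \<in> H j}" "n \<le> k + card ({..<n}-{i})"
      using bound[of "{..<n} - {i}"] by auto
    have "{x \<in> B. \<forall>j\<in>{..<n}-{i}. x \<in> H j} \<subseteq> {\<zero>}"
      using neg by auto
    hence "k \<le> 0"
      using dimension_mono[OF k(1) zero_dim] by auto
    thus False
      using k(2) i by auto
  qed
  then obtain b where b: "\<And>i. i < n \<Longrightarrow> b i \<in> B" "\<And>i j. i < n \<Longrightarrow> j < n \<Longrightarrow> j \<noteq> i \<Longrightarrow> b i \<in> H j"
      "\<And>i. i < n \<Longrightarrow> b i \<noteq> \<zero>"
    by metis
  have bH: "b i \<notin> H i" if "i < n" for i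
  proof
    assume "b i \<in> H i"
    hence "\<forall>j<n. b i \<in> H j"
      using b(2)[OF that] by blast
    hence "b i \<in> {\<zero>}"
      unfolding trivial[symmetric] using b(1)[OF that] by simp
    thus False
      using b(3)[OF that] by simp
  qed
  have bcarr: "b i \<in> carrier R" if "i < n" for i
    using b(1)[OF that] subspaceD(1)[OF Bsub] by auto
  \<comment> \<open>This is stated for arbitrary lists of distinct indices, since it is needed both
    for the full list and for the list with one index removed. The head lies outside a hyperplane
    that contains the tail.\<close>
  have ind: "independent K (map b is)" if "distinct is" "set is \<subseteq> {..<n}" for "is"
    using that
  proof (induction "is")
    case (Cons i js)
    have "Span K (map b js) \<subseteq> H i"
      using Cons.prems b(2) by (intro subalgebra_Span_incl[OF K Hsub]) fastforce+
    hence "b i \<notin> Span K (map b js)"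
      using bH[of i] Cons.prems by auto
    thus ?case
      using Cons bcarr by (auto intro: li_Cons)
  qed auto
  let ?bs = "map b [0..<n]"
  show thesis
  proof (rule that)
    show i: "independent K ?bs"
      by (rule ind) auto
    show "Span K ?bs = B"
      using independent_length_eq_dimension[OF K B i] b(1)
      by (simp add: image_subset_iff del: Span.simps)
    fix i assume "i < n"
    hence eq: "take i ?bs @ drop (Suc i) ?bs = map b (take i [0..<n] @ drop (Suc i) [0..<n])"
      by (simp add: take_map drop_map)
    obtain h where h: "dimension h K (H i)" "Suc h = n"
      using H(2)[OF \<open>i < n\<close>] by auto
    have "independent K (take i ?bs @ drop (Suc i) ?bs)"
      unfolding eq by (rule ind) (use \<open>i < n\<close> in auto)
    moreover have "set (take i ?bs @ drop (Suc i) ?bs) \<subseteq> H i"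
      unfolding eq using \<open>i < n\<close> b(2) by auto
    moreover have "length (take i ?bs @ drop (Suc i) ?bs) = h"
      using \<open>i < n\<close> h(2) by auto
    ultimately show "Span K (take i ?bs @ drop (Suc i) ?bs) = H i"
      using independent_length_eq_dimension[OF K h(1)] by blast
  qed
qed

section \<open>Products of subspaces and the linear Cauchy-Davenport inequality\<close>

lemma dimension_image_mult:
  assumes "dimension n K E" "e \<in> carrier R" "e \<noteq> \<zero>"
    and dom: "domain R"
  shows "dimension n K ((\<otimes>) e ` E)"
  using assms(1)
proof (induction n arbitrary: E)
  case 0
  thus ?case
    using assms(2) dimension_zero[OF K 0] by auto
next
  case (Suc n)
  obtain v E' where v: "v \<in> carrier R" "v \<notin> E'" "dimension n K E'" and eq: "E = line_extension K v E'"
    using dimension_backwards[OF K Suc.prems] by auto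
  interpret domain R by (rule dom)
  have E: "E' \<subseteq> carrier R"
    using subspaceD(1)[OF dimension_subspace[OF v(3)]] .
  have KR: "K \<subseteq> carrier R"
    using subfieldE(3)[OF K] .
  have "e \<otimes> v \<notin> (\<otimes>) e ` E'"
    using v(1,2) E assms(2,3) m_lcancel by auto
  hence "dimension (Suc n) K (line_extension K (e \<otimes> v) ((\<otimes>) e ` E'))"
    using v Suc.IH assms(2) by (intro dimension.Suc_dim) auto
  moreover have "e \<otimes> (k \<otimes> v \<oplus> x) = k \<otimes> (e \<otimes> v) \<oplus> e \<otimes> x" if "k \<in> K" "x \<in> E'" for k x
  proof -
    have "k \<in> carrier R" "x \<in> carrier R"
      using that KR E by auto
    thus ?thesis
      using assms(2) v(1) by (simp add: r_distr m_lcomm)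
  qed
  hence "line_extension K (e \<otimes> v) ((\<otimes>) e ` E') = (\<otimes>) e ` line_extension K v E'"
    by (auto simp: set_eq_iff line_extension_mem_iff image_iff Bex_def) metis+
  ultimately show ?case
    unfolding eq by simp
qed

end

end

text \<open>Dimensions computed in \<complex> are carried over by this to a subfield of \<complex>
  regarded as a ring of its own.\<close>

lemma (in ring) dimension_consistent:
  assumes L: "subring L R" and K: "subfield K R" "K \<subseteq> L" and "dimension n K E" "E \<subseteq> L"
  shows "ring.dimension (R\<lparr>carrier := L\<rparr>) n K E"
proof -
  interpret L: ring "R\<lparr>carrier := L\<rparr>"
    using subring_is_ring[OF L] .
  obtain Us where Us: "set Us \<subseteq> carrier R" "independent K Us" "length Us = n" "Span K Us = E"
    using exists_base[OF K(1) assms(4)] by auto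
  have "set Us \<subseteq> L"
    using Span_base_incl[OF K(1) Us(1)] Us(4) assms(5) by auto
  with Us(2) have "L.independent K Us"
  proof (induction rule: independent.induct)
    case (li_Cons u K Us)
    thus ?case
      using Span_consistent[OF L] by (intro L.li_Cons) auto
  qed auto
  thus ?thesis
    using L.dimension_independent[of K Us] Us(3,4) Span_consistent[OF L] by simp
qed

text \<open>Induction on \<open>dim T\<close> by Dyson's transform \<open>(S, T) \<mapsto> (S + e T, T \<inter> e\<inverse> S)\<close>.\<close>

lemma (in field) linear_cauchy_davenport:
  assumes K: "subfield K R"
    and no_intermediate: "\<And>M. subfield M R \<Longrightarrow> K \<subseteq> M \<Longrightarrow> M = K \<or> M = carrier R"
    and fin: "finite_dimension K (carrier R)"
    and A: "dimension a K A" "A \<noteq> carrier R"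
    and S: "dimension s K S" "S \<noteq> {\<zero>}"
    and T: "dimension t K T" "\<one> \<in> T"
    and prod: "\<And>x y. x \<in> S \<Longrightarrow> y \<in> T \<Longrightarrow> x \<otimes> y \<in> A"
  shows "s + t \<le> Suc a"
  using S T prod
proof (induction t arbitrary: s S T rule: less_induct)
  case (less t)
  note S = less.prems(1,2) and T = less.prems(3,4) and prod = less.prems(5)
  note Ssub = subspaceD[OF K dimension_subspace[OF K S(1)]]
  note Tsub = subspaceD[OF K dimension_subspace[OF K T(1)]]
  note Asub = subspaceD[OF K dimension_subspace[OF K A(1)]]
  have SA: "S \<subseteq> A"
  proof
    fix x assume "x \<in> S"
    thus "x \<in> A"
      using prod[OF _ T(2), of x] Ssub(1) by auto
  qed
  show ?case
  proof (cases "\<forall>x\<in>S. \<forall>y\<in>T. x \<otimes> y \<in> S")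
    case stable: True
    \<comment> \<open>The stabiliser of \<open>S\<close> is a subring containing \<open>K\<close>;
      in the present case it contains \<open>T\<close> as well.\<close>
    define St where "St = {y \<in> carrier R. \<forall>x\<in>S. x \<otimes> y \<in> S}"
    have "subring St R"
    proof (rule subringI)
      show "\<ominus> y \<in> St" if "y \<in> St" for y
      proof -
        have "x \<otimes> \<ominus> y \<in> S" if "x \<in> S" for x
        proof -
          have "\<ominus> x \<in> S"
            using space_subgroup_props(4)[OF K S(1) that] .
          hence "\<ominus> x \<otimes> y \<in> S"
            using \<open>y \<in> St\<close> unfolding St_def by auto
          thus ?thesis
            using that Ssub(1) \<open>y \<in> St\<close> unfolding St_def by (simp add: l_minus r_minus subset_iff)
        qed
        thus ?thesis
          using that unfolding St_def by auto
      qed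
      show "y \<otimes> z \<in> St" if "y \<in> St" "z \<in> St" for y z
      proof -
        have "x \<otimes> (y \<otimes> z) \<in> S" if "x \<in> S" for x
        proof -
          have "x \<otimes> y \<otimes> z \<in> S"
            using that \<open>y \<in> St\<close> \<open>z \<in> St\<close> unfolding St_def by auto
          thus ?thesis
            using that Ssub(1) \<open>y \<in> St\<close> \<open>z \<in> St\<close> unfolding St_def by (simp add: m_assoc subset_iff)
        qed
        thus ?thesis
          using that unfolding St_def by auto
      qed
      show "y \<oplus> z \<in> St" if "y \<in> St" "z \<in> St" for y z
        using that Ssub(1,3) unfolding St_def by (simp add: r_distr subset_iff)
    qed (use Ssub(1) in \<open>auto simp: St_def subset_iff\<close>)
    have KSt: "K \<subseteq> St"
    proof
      fix k assume "k \<in> K"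
      moreover from this have "k \<in> carrier R"
        using subfieldE(3)[OF K] by auto
      ultimately show "k \<in> St"
        using Ssub(1,4) m_comm[of _ k] unfolding St_def by (auto simp: subset_iff)
    qed
    \<comment> \<open>An element of \<open>T\<close> outside \<open>K\<close> generates the whole
      field, which therefore stabilises \<open>S\<close>. As \<open>S\<close> contains a nonzero
      element, \<open>S\<close> and hence \<open>A\<close> would be everything.\<close>
    have "T \<subseteq> K"
    proof (rule ccontr)
      assume "\<not> T \<subseteq> K"
      then obtain y where y: "y \<in> T" "y \<notin> K" by auto
      have yc: "y \<in> carrier R" using y(1) Tsub(1) by auto
      have "(algebraic over K) y"
        using finite_dimension_imp_algebraic[OF K carrier_is_subring fin yc] .
      hence "subfield (simple_extension K y) R"
        using simple_extension_is_subfield[OF K yc] by simp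
      moreover have "K \<subseteq> simple_extension K y" "y \<in> simple_extension K y"
        using simple_extension_incl[OF subfieldE(3)[OF K] yc]
          simple_extension_mem[OF subfieldE(1)[OF K] yc] by auto
      ultimately have "simple_extension K y = carrier R"
        using no_intermediate y(2) by blast
      moreover have "y \<in> St"
        using y(1) yc stable unfolding St_def by auto
      ultimately have St: "St = carrier R"
        using simple_extension_subring_incl[OF \<open>subring St R\<close> KSt] unfolding St_def by auto
      obtain x where x: "x \<in> S" "x \<noteq> \<zero>"
        using S(2) Ssub(2) by auto
      have "z \<in> S" if "z \<in> carrier R" for z
      proof -
        have xc: "x \<in> carrier R" "x \<in> Units R"
          using x Ssub(1) field_Units by auto
        hence "x \<otimes> (inv x \<otimes> z) \<in> S"
          using x(1) that St unfolding St_def by (metis (no_types, lifting) St_def Units_inv_closed m_closed mem_Collect_eq St)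
        thus ?thesis
          using xc that by (simp add: m_assoc[symmetric])
      qed
      thus False
        using SA A(2) Asub(1) by auto
    qed
    hence "t \<le> 1"
      using dimension_mono[OF K T(1) dimension_one[OF K]] by simp
    moreover have "s \<le> a"
      using dimension_mono[OF K S(1) A(1) SA] .
    ultimately show ?thesis by linarith
  next
    case False
    \<comment> \<open>Since \<open>e \<otimes> y\<close> is outside \<open>S\<close>, the transform
      makes \<open>T\<close> strictly smaller; since \<open>e\<close> is in \<open>S\<close>, the
      new \<open>T'\<close> still contains \<one>.\<close>
    then obtain e y where e: "e \<in> S" "y \<in> T" "e \<otimes> y \<notin> S" by auto
    have ec: "e \<in> carrier R" "e \<noteq> \<zero>"
      using e Ssub(1,2) Tsub(1) by auto
    define eT where "eT = (\<otimes>) e ` T"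
    have eT: "dimension t K eT"
      unfolding eT_def by (rule dimension_image_mult[OF K T(1) ec domain_axioms])
    have sub: "subalgebra K (S \<inter> eT) R"
      using subalgebra_inter dimension_subspace[OF K] S(1) eT by blast
    obtain k where k: "dimension k K (S \<inter> eT)"
      using subspace_dimension[OF K S(1) sub] by auto
    have "k \<le> t"
      using dimension_mono[OF K k eT] by simp
    moreover have "k \<noteq> t"
      using dimension_eq_imp_eq[OF K _ eT, of "S \<inter> eT"] k e unfolding eT_def by blast
    ultimately have kt: "k < t" by simp
    define T' where "T' = (\<otimes>) (inv e) ` (S \<inter> eT)"
    have eU: "e \<in> Units R" "inv e \<in> carrier R" "inv e \<noteq> \<zero>"
      using ec field_Units Units_inv_Units by auto
    have T': "dimension k K T'"
      unfolding T'_def by (rule dimension_image_mult[OF K k eU(2,3) domain_axioms])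
    have "inv e \<otimes> (e \<otimes> z) = z" if "z \<in> T" for z
      using that Tsub(1) eU ec by (simp add: m_assoc[symmetric] subset_iff)
    hence T'_iff: "z \<in> T' \<longleftrightarrow> z \<in> T \<and> e \<otimes> z \<in> S" for z
      unfolding T'_def eT_def by (force simp: image_iff)
    have S': "dimension (s + t - k) K (S <+>\<^bsub>R\<^esub> eT)"
      using dimension_sum_space[OF K S(1) eT k] .
    have S'_iff: "z \<in> S <+>\<^bsub>R\<^esub> eT \<longleftrightarrow> (\<exists>x\<in>S. \<exists>y\<in>T. z = x \<oplus> e \<otimes> y)" for z
      unfolding set_add_def' eT_def by auto
    \<comment> \<open>The transform preserves the sum of the two dimensions; as
      \<open>k < t\<close>, the subtraction is not truncated.\<close>
    have "(s + t - k) + k \<le> Suc a"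
    proof (rule less.IH[OF kt S' _ T'])
      have "e \<oplus> e \<otimes> \<zero> \<in> S <+>\<^bsub>R\<^esub> eT"
        unfolding S'_iff using e(1) Tsub(2) by blast
      thus "S <+>\<^bsub>R\<^esub> eT \<noteq> {\<zero>}"
        using ec by auto
      show "\<one> \<in> T'"
        unfolding T'_iff using T(2) e(1) ec by auto
      fix x z assume x: "x \<in> S <+>\<^bsub>R\<^esub> eT" and z: "z \<in> T'"
      obtain x' y' where x': "x' \<in> S" "y' \<in> T" "x = x' \<oplus> e \<otimes> y'"
        using x unfolding S'_iff by auto
      have z': "z \<in> T" "e \<otimes> z \<in> S"
        using z unfolding T'_iff by auto
      have carr: "x' \<in> carrier R" "y' \<in> carrier R" "z \<in> carrier R"
        using x' z' Ssub(1) Tsub(1) by auto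
      \<comment> \<open>By commutativity \<open>e\<close> moves over to \<open>z\<close>, and both
        summands become products of an element of \<open>S\<close> with an element of
        \<open>T\<close>.\<close>
      have "x \<otimes> z = x' \<otimes> z \<oplus> (e \<otimes> z) \<otimes> y'"
        unfolding x'(3) using carr ec by algebra
      moreover have "x' \<otimes> z \<in> A" "(e \<otimes> z) \<otimes> y' \<in> A"
        using prod x' z' by auto
      ultimately show "x \<otimes> z \<in> A"
        using Asub(3) by auto
    qed
    thus ?thesis using kt by linarith
  qed
qed

theorem (in field) linear_matching_property_if_no_intermediate_field:
  assumes K: "subfield K R"
    and no_intermediate: "\<And>M. subfield M R \<Longrightarrow> K \<subseteq> M \<Longrightarrow> M = K \<or> M = carrier R"
    and fin: "finite_dimension K (carrier R)"
  shows "linear_matching_property K"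
  unfolding linear_matching_property_def matched_subspaces_def
proof (intro allI impI, elim conjE)
  fix m A B as
  assume "1 \<le> m" and A: "dimension m K A" and B: "dimension m K B" and "\<one> \<notin> B"
    and basis: "is_basis K A as"
  note Asub = subspaceD[OF K dimension_subspace[OF K A]]
  note Bsub = subspaceD[OF K dimension_subspace[OF K B]]
  have as: "independent K as" "Span K as = A"
    using basis unfolding is_basis_def by auto
  have asc: "set as \<subseteq> carrier R"
    using independent_in_carrier[OF as(1)] .
  have len: "length as = m"
    using dimension_is_inj[OF K _ A] dimension_independent[OF as(1)] as(2) by simp
  \<comment> \<open>Otherwise \<open>B\<close>, having the same dimension, would be everything and
    would contain \<one>.\<close>
  have "A \<noteq> carrier R"
  proof
    assume "A = carrier R"
    hence "B = carrier R"
      using dimension_eq_imp_eq[OF K B A] Bsub(1) by simp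
    thus False
      using \<open>\<one> \<notin> B\<close> by simp
  qed
  \<comment> \<open>\<open>V i\<close> collects the vectors that matching forces into the hyperplane
    opposite to the i-th vector of the basis sought.\<close>
  define V where "V = (\<lambda>i. {b \<in> B. as ! i \<otimes> b \<in> A})"
  have Vsub: "subalgebra K (V i) R" if "i < m" for i
  proof -
    have a: "as ! i \<in> carrier R"
      using that len asc nth_mem by blast
    show ?thesis
    proof (rule subspaceI[OF K])
      show "x \<oplus> y \<in> V i" if "x \<in> V i" "y \<in> V i" for x y
        using that a Asub(1,3) Bsub(1,3) unfolding V_def by (auto simp: r_distr subset_iff)
      show "k \<otimes> x \<in> V i" if "k \<in> K" "x \<in> V i" for k x
      proof -
        have "k \<in> carrier R" "x \<in> carrier R"
          using that subfieldE(3)[OF K] Bsub(1) unfolding V_def by auto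
        hence "as ! i \<otimes> (k \<otimes> x) = k \<otimes> (as ! i \<otimes> x)"
          using a by (simp add: m_lcomm)
        thus ?thesis
          using that Asub(4) Bsub(4) unfolding V_def by auto
      qed
    qed (use a Asub Bsub in \<open>auto simp: V_def\<close>)
  qed
  have rank: "k + card J \<le> m"
    if J: "J \<subseteq> {..<m}" and k: "dimension k K {x \<in> B. \<forall>i\<in>J. x \<in> V i}" for J k
  proof (cases "J = {}")
    case True
    thus ?thesis
      using dimension_is_inj[OF K k, of m] B by simp
  next
    case False
    let ?W = "{x \<in> B. \<forall>i\<in>J. x \<in> V i}"
    note Wsub = subspaceD[OF K dimension_subspace[OF K k]]
    have finJ: "finite J" using J finite_subset by auto
    define js where "js = map ((!) as) (sorted_list_of_set J)"
    have "distinct as"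
      using independent_distinct[OF K as(1)] .
    hence "inj_on ((!) as) J"
      using J len by (intro inj_on_nth) auto
    hence js: "set js \<subseteq> set as" "distinct js" "length js = card J" "set js = (!) as ` J"
      unfolding js_def using finJ J len by (auto simp: distinct_map)
    have ind: "independent K js"
      using independent_subset[OF K as(1) js(1,2)] .
    have S: "dimension (card J) K (Span K js)"
      using dimension_independent[OF ind] js(3) by simp
    have "js \<noteq> []"
      using js(3) False finJ by auto
    hence "Span K js \<noteq> {\<zero>}"
      using dimension_is_inj[OF K S, of 0] js(3) zero_dim by auto
    \<comment> \<open>Because \<one> is not in \<open>B\<close>, adjoining it raises the dimension
      by exactly one, which compensates the \<open>Suc\<close> in the Cauchy-Davenport
      bound.\<close>
    have "\<one> \<notin> ?W" using \<open>\<one> \<notin> B\<close> by auto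
    hence T: "dimension (Suc k) K (line_extension K \<one> ?W)"
      using k by (intro Suc_dim) auto
    have "\<one> = \<one> \<otimes> \<one> \<oplus> \<zero>" by simp
    hence oneT: "\<one> \<in> line_extension K \<one> ?W"
      unfolding line_extension_mem_iff using subringE(3)[OF subfieldE(1)[OF K]] Wsub(2) by blast
    have "card J + Suc k \<le> Suc m"
    proof (rule linear_cauchy_davenport[OF K no_intermediate fin A \<open>A \<noteq> carrier R\<close> S \<open>Span K js \<noteq> {\<zero>}\<close> T oneT])
      fix x y assume x: "x \<in> Span K js" and y: "y \<in> line_extension K \<one> ?W"
      obtain c w where cw: "c \<in> K" "w \<in> ?W" "y = c \<otimes> \<one> \<oplus> w"
        using y unfolding line_extension_mem_iff by auto
      have wc: "w \<in> carrier R" "c \<in> carrier R"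
        using cw Wsub(1) subfieldE(3)[OF K] by auto
      have jsc: "set js \<subseteq> carrier R"
        using js(1) asc by auto
      have xc: "x \<in> carrier R"
        using Span_in_carrier[OF subfieldE(3)[OF K] jsc] x by auto
      have xA: "x \<in> A"
        using mono_Span_sublist[OF K js(1) asc] x as(2) by auto
      have "subalgebra K {z \<in> carrier R. z \<otimes> w \<in> A} R"
      proof (rule subspaceI[OF K])
        show "k \<otimes> z \<in> {z \<in> carrier R. z \<otimes> w \<in> A}"
          if "k \<in> K" "z \<in> {z \<in> carrier R. z \<otimes> w \<in> A}" for k z
        proof -
          have "k \<in> carrier R" using that subfieldE(3)[OF K] by auto
          thus ?thesis
            using that Asub(4) wc by (auto simp: m_assoc)
        qed
      qed (use wc Asub in \<open>auto simp: l_distr\<close>)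
      moreover have "set js \<subseteq> {z \<in> carrier R. z \<otimes> w \<in> A}"
        using cw(2) jsc js(4) unfolding V_def by auto
      ultimately have "x \<otimes> w \<in> A"
        using subalgebra_Span_incl[OF K] x by blast
      moreover have "c \<otimes> x \<in> A"
        using Asub(4) cw(1) xA by auto
      moreover have "x \<otimes> y = c \<otimes> x \<oplus> x \<otimes> w"
        unfolding cw(3) using wc xc by algebra
      ultimately show "x \<otimes> y \<in> A"
        using Asub(3) by auto
    qed
    thus ?thesis by simp
  qed
  have "\<exists>H. (\<forall>i\<in>{..<m}. V i \<subseteq> H i \<and> hyperplane K B (H i)) \<and>
             (\<exists>k. dimension k K {x \<in> B. \<forall>i\<in>{..<m}. x \<in> H i} \<and> k + card {..<m} = m)"
    using Vsub rank by (intro hyperplane_transversal[OF K B _ _ _ B]) (auto simp: V_def)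
  \<comment> \<open>There are \<open>m\<close> indices, so the equation between the dimensions
    leaves a zero-dimensional intersection.\<close>
  then obtain H where H: "\<forall>i\<in>{..<m}. V i \<subseteq> H i \<and> hyperplane K B (H i)"
    and "dimension 0 K {x \<in> B. \<forall>i\<in>{..<m}. x \<in> H i}"
    by auto
  from this(2) have "{x \<in> B. \<forall>i\<in>{..<m}. x \<in> H i} = {\<zero>}"
    by (rule dimension_zero[OF K])
  hence trivial: "{x \<in> B. \<forall>i<m. x \<in> H i} = {\<zero>}"
    by (simp add: lessThan_iff Ball_def)
  obtain bs where bs: "independent K bs" "Span K bs = B"
    "\<And>i. i < m \<Longrightarrow> Span K (take i bs @ drop (Suc i) bs) = H i"
    by (rule dual_basis_of_hyperplanes[OF K B _ trivial]) (use H in auto)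
  have "matched_bases K A B as bs"
    unfolding matched_bases_def
  proof (intro ballI allI impI)
    fix b i assume "b \<in> B" "i < length as" "as ! i \<otimes> b \<in> A"
    thus "b \<in> Span K (take i bs @ drop (Suc i) bs)"
      using bs(3)[of i] len H unfolding V_def by auto
  qed
  thus "\<exists>bs. is_basis K B bs \<and> matched_bases K A B as bs"
    using bs(1,2) unfolding is_basis_def by blast
qed

section \<open>Valuation rings\<close>

text \<open>A valuation ring is a subset of a field type here, so that two of them can be used side
  by side on \<complex>.\<close>

locale valuation_subring =
  fixes A :: "'a::field set"
  assumes one: "1 \<in> A"
    and diff: "x \<in> A \<Longrightarrow> y \<in> A \<Longrightarrow> x - y \<in> A"
    and mult: "x \<in> A \<Longrightarrow> y \<in> A \<Longrightarrow> x * y \<in> A"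
    and total: "x \<in> A \<or> inverse x \<in> A"
begin

text \<open>Zero is listed separately because \<open>inverse 0 = 0\<close> belongs to
  \<open>A\<close>.\<close>

definition max_ideal :: "'a set" where
  "max_ideal = {x \<in> A. x = 0 \<or> inverse x \<notin> A}"

text \<open>Equality of values, that is, the quotient is a unit of \<open>A\<close>. This relation
  replaces the value group, which is never constructed.\<close>

definition equiv_val :: "'a \<Rightarrow> 'a \<Rightarrow> bool" (infix "\<asymp>" 50) where
  "x \<asymp> y \<longleftrightarrow> x \<noteq> 0 \<and> y \<noteq> 0 \<and> x / y \<in> A \<and> y / x \<in> A"

lemma zero: "0 \<in> A"
  using diff[OF one one] by simp

lemma uminus: "x \<in> A \<Longrightarrow> - x \<in> A"
  using diff[OF zero] by simp

lemma add: "x \<in> A \<Longrightarrow> y \<in> A \<Longrightarrow> x + y \<in> A"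
  using diff[of x "- y"] uminus by simp

lemma power: "x \<in> A \<Longrightarrow> x ^ n \<in> A"
  by (induction n) (auto intro: one mult)

lemma max_ideal_subset: "x \<in> max_ideal \<Longrightarrow> x \<in> A"
  by (simp add: max_ideal_def)

lemma not_in_max_ideal: "x \<notin> max_ideal \<longleftrightarrow> x \<noteq> 0 \<and> inverse x \<in> A"
  using total[of x] zero by (auto simp: max_ideal_def)

lemma inverse_in_max_ideal: "x \<notin> A \<Longrightarrow> inverse x \<in> max_ideal"
  using total[of x] by (auto simp: max_ideal_def)

lemma one_notin_max_ideal: "1 \<notin> max_ideal"
  by (simp add: not_in_max_ideal one)

lemma max_ideal_mult:
  assumes "x \<in> A" "y \<in> max_ideal" shows "x * y \<in> max_ideal"
proof (rule ccontr)
  assume "x * y \<notin> max_ideal"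
  hence nz: "x * y \<noteq> 0" "inverse (x * y) \<in> A"
    by (auto simp: not_in_max_ideal)
  hence "inverse y = x * inverse (x * y)"
    by (simp add: field_simps)
  hence "inverse y \<in> A" using mult[OF assms(1) nz(2)] by metis
  thus False using assms(2) nz(1) by (auto simp: max_ideal_def)
qed

lemma max_ideal_uminus: "x \<in> max_ideal \<Longrightarrow> - x \<in> max_ideal"
  using max_ideal_mult[OF uminus[OF one], of x] by simp

lemma max_ideal_add:
  assumes "x \<in> max_ideal" "y \<in> max_ideal" shows "x + y \<in> max_ideal"
proof (cases "x = 0 \<or> y = 0")
  case True
  thus ?thesis using assms by auto
next
  case False
  consider "x / y \<in> A" | "y / x \<in> A"
    using total[of "x / y"] by (auto simp: field_simps)
  thus ?thesis
  proof cases
    case 1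
    thus ?thesis
      using max_ideal_mult[OF add[OF one 1] assms(2)] False by (simp add: field_simps)
  next
    case 2
    thus ?thesis
      using max_ideal_mult[OF add[OF one 2] assms(1)] False by (simp add: field_simps)
  qed
qed

lemma max_ideal_power:
  assumes "x \<in> max_ideal" "n > 0" shows "x ^ n \<in> max_ideal"
  using max_ideal_mult[OF power[OF max_ideal_subset[OF assms(1)], of "n - 1"] assms(1)] assms(2)
  by (simp add: power_eq_if mult.commute)

lemma max_ideal_prime:
  assumes "x * y \<in> max_ideal" shows "x \<in> max_ideal \<or> y \<in> max_ideal"
  using assms not_in_max_ideal[of x] not_in_max_ideal[of y] not_in_max_ideal[of "x * y"]
    mult[of "inverse x" "inverse y"] by auto

lemma max_ideal_power_imp: "x ^ n \<in> max_ideal \<Longrightarrow> x \<in> max_ideal"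
  by (induction n) (use one_notin_max_ideal max_ideal_prime in auto)

lemma one_plus_equiv:
  assumes "x \<in> max_ideal" shows "1 + x \<asymp> 1"
proof -
  have "1 + x \<notin> max_ideal"
  proof
    assume "1 + x \<in> max_ideal"
    hence "(1 + x) + - x \<in> max_ideal"
      by (rule max_ideal_add[OF _ max_ideal_uminus[OF assms]])
    thus False using one_notin_max_ideal by simp
  qed
  thus ?thesis
    using add[OF one max_ideal_subset[OF assms]]
    by (auto simp: equiv_val_def not_in_max_ideal inverse_eq_divide)
qed

lemma equiv_refl: "x \<noteq> 0 \<Longrightarrow> x \<asymp> x"
  by (simp add: equiv_val_def one)

lemma equiv_sym: "x \<asymp> y \<Longrightarrow> y \<asymp> x"
  by (simp add: equiv_val_def)

lemma equiv_trans [trans]: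
  assumes "x \<asymp> y" "y \<asymp> z" shows "x \<asymp> z"
  using assms mult[of "x / y" "y / z"] mult[of "z / y" "y / x"]
  by (auto simp: equiv_val_def)

lemma equiv_mult:
  assumes "x \<asymp> y" "z \<asymp> w" shows "x * z \<asymp> y * w"
  using assms mult[of "x / y" "z / w"] mult[of "y / x" "w / z"]
  by (auto simp: equiv_val_def)

lemma equiv_inverse: "x \<asymp> y \<Longrightarrow> inverse x \<asymp> inverse y"
  by (auto simp: equiv_val_def field_simps)

lemma equiv_divide: "x \<asymp> y \<Longrightarrow> z \<asymp> w \<Longrightarrow> x / z \<asymp> y / w"
  using equiv_mult[of x y "inverse z" "inverse w"] equiv_inverse by (simp add: field_simps)

lemma equiv_power: "x \<asymp> y \<Longrightarrow> x ^ n \<asymp> y ^ n"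
  by (induction n) (auto intro: equiv_mult equiv_refl)

lemma equiv_power_int: "x \<asymp> y \<Longrightarrow> x powi k \<asymp> y powi k"
  by (cases "k \<ge> 0") (auto simp: power_int_def intro: equiv_power equiv_inverse)

lemma equiv_max_ideal:
  assumes "x \<asymp> y" "y \<in> max_ideal" shows "x \<in> max_ideal"
  using max_ideal_mult[of "x / y" y] assms by (auto simp: equiv_val_def)

lemma equiv_one_iff: "x \<asymp> 1 \<longleftrightarrow> x \<in> A \<and> x \<notin> max_ideal"
  by (auto simp: equiv_val_def not_in_max_ideal inverse_eq_divide)

lemma add_max_ideal_equiv:
  assumes "x \<asymp> 1" "y \<in> max_ideal" shows "x + y \<asymp> 1"
proof -
  have "y / x \<in> max_ideal"
    using max_ideal_mult[of "1 / x" y] assms by (auto simp: equiv_val_def)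
  hence "x * (1 + y / x) \<asymp> 1 * 1"
    by (intro equiv_mult one_plus_equiv assms)
  thus ?thesis
    using assms(1) by (simp add: equiv_val_def distrib_left)
qed

text \<open>The value group is ordered and therefore torsion-free.\<close>

lemma equiv_power_one_imp: 
  assumes "x ^ n \<asymp> 1" "n > 0" shows "x \<asymp> 1"
proof -
  have "x \<notin> max_ideal"
    using assms max_ideal_power equiv_one_iff by blast
  moreover have "inverse x \<notin> max_ideal"
    using assms max_ideal_power[of "inverse x" n] equiv_inverse[OF assms(1)] equiv_one_iff[of "inverse (x ^ n)"]
    by (auto simp: power_inverse)
  ultimately show ?thesis
    using not_in_max_ideal[of x] not_in_max_ideal[of "inverse x"] equiv_one_iff by auto
qed

text \<open>A positive value has infinite order in the value group. The case \<open>x = 0\<close> is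
  covered as well, since zero is equivalent to nothing.\<close>

lemma power_int_equiv_one_imp:
  assumes "x \<in> max_ideal" "x powi k \<asymp> 1" shows "k = 0"
proof (rule ccontr)
  assume "k \<noteq> 0"
  have "x ^ nat \<bar>k\<bar> \<asymp> 1"
    using assms(2) equiv_inverse[OF assms(2)] by (cases "k \<ge> 0") (auto simp: power_int_def power_inverse)
  hence "x \<asymp> 1"
    by (rule equiv_power_one_imp) (use \<open>k \<noteq> 0\<close> in auto)
  thus False
    using assms(1) equiv_one_iff by auto
qed

lemma power_int_equiv_imp_eq:
  assumes "x \<in> max_ideal" "x powi i \<asymp> x powi j" shows "i = j"
proof -
  have "x \<noteq> 0 \<or> i = 0 \<and> j = 0"
    using assms(2) by (auto simp: equiv_val_def)
  moreover have "x powi (i - j) \<asymp> 1" if "x \<noteq> 0"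
    using equiv_divide[OF assms(2) equiv_refl[of "x powi j"]] that by (simp add: power_int_diff)
  ultimately show ?thesis
    using power_int_equiv_one_imp[OF assms(1), of "i - j"] by auto
qed

text \<open>When the values of the terms are pairwise distinct, one term dominates and nothing can
  cancel. In the induction the new term is either negligible against the old dominant term or
  dominates the whole previous sum.\<close>

lemma sum_equiv_term:
  assumes "finite I" "I \<noteq> {}" "\<And>i. i \<in> I \<Longrightarrow> t i \<noteq> 0"
    and "\<And>i j. i \<in> I \<Longrightarrow> j \<in> I \<Longrightarrow> i \<noteq> j \<Longrightarrow> \<not> t i \<asymp> t j"
  shows "\<exists>i\<in>I. sum t I \<asymp> t i"
  using assms
proof (induction I rule: finite_ne_induct)
  case (singleton i)
  thus ?case by (auto intro: equiv_refl)
next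
  case (insert j I)
  then obtain i where i: "i \<in> I" "sum t I \<asymp> t i"
    by auto
  have nz: "t i \<noteq> 0" "t j \<noteq> 0"
    using insert.prems i by auto
  have "\<not> t j \<asymp> t i"
    using insert.prems(2)[of j i] insert.hyps i by auto
  hence "t j / t i \<in> max_ideal \<or> t i / t j \<in> max_ideal"
    using nz total[of "t j / t i"] by (auto simp: equiv_val_def max_ideal_def)
  thus ?case
  proof
    assume "t j / t i \<in> max_ideal"
    hence "sum t I / t i + t j / t i \<asymp> 1"
      using equiv_divide[OF i(2) equiv_refl[of "t i"]] nz by (intro add_max_ideal_equiv) auto
    hence "t i * (sum t I / t i + t j / t i) \<asymp> t i * 1"
      by (intro equiv_mult equiv_refl nz)
    moreover have "t i * (sum t I / t i + t j / t i) = t j + sum t I"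
      using nz by (simp add: distrib_left)
    ultimately have "t j + sum t I \<asymp> t i"
      by simp
    thus ?thesis
      using i insert.hyps by auto
  next
    assume *: "t i / t j \<in> max_ideal"
    have "sum t I / t i \<asymp> 1"
      using equiv_divide[OF i(2) equiv_refl[of "t i"]] nz by simp
    hence "sum t I / t i * (t i / t j) \<in> max_ideal"
      using * by (intro max_ideal_mult) (auto simp: equiv_one_iff)
    hence "1 + sum t I / t j \<asymp> 1"
      using nz by (intro one_plus_equiv) simp
    hence "t j * (1 + sum t I / t j) \<asymp> t j * 1"
      by (intro equiv_mult equiv_refl nz)
    hence "t j + sum t I \<asymp> t j"
      using nz by (simp add: distrib_left)
    thus ?thesis
      using i insert.hyps by auto
  qed
qed

end

section \<open>Subfields, ramification and discreteness\<close>

definition subfield_set :: "'a::field set \<Rightarrow> bool" where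
  "subfield_set F \<longleftrightarrow> 1 \<in> F \<and> (\<forall>x\<in>F. \<forall>y\<in>F. x - y \<in> F \<and> x * y \<in> F \<and> inverse x \<in> F)"

lemma subfield_setD:
  assumes "subfield_set F"
  shows "1 \<in> F" "0 \<in> F" "x \<in> F \<Longrightarrow> - x \<in> F" "x \<in> F \<Longrightarrow> y \<in> F \<Longrightarrow> x + y \<in> F"
    "x \<in> F \<Longrightarrow> y \<in> F \<Longrightarrow> x - y \<in> F" "x \<in> F \<Longrightarrow> y \<in> F \<Longrightarrow> x * y \<in> F"
    "x \<in> F \<Longrightarrow> inverse x \<in> F" "x \<in> F \<Longrightarrow> y \<in> F \<Longrightarrow> x / y \<in> F"
    "x \<in> F \<Longrightarrow> x ^ n \<in> F" "x \<in> F \<Longrightarrow> x powi k \<in> F" "of_nat m \<in> F"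
proof -
  show 1: "1 \<in> F" and d: "x \<in> F \<Longrightarrow> y \<in> F \<Longrightarrow> x - y \<in> F" and m: "x \<in> F \<Longrightarrow> y \<in> F \<Longrightarrow> x * y \<in> F"
    and i: "x \<in> F \<Longrightarrow> inverse x \<in> F" for x y
    using assms by (auto simp: subfield_set_def)
  show 0: "0 \<in> F" using d[OF 1 1] by simp
  show u: "x \<in> F \<Longrightarrow> - x \<in> F" for x using d[OF 0] by simp
  show a: "x \<in> F \<Longrightarrow> y \<in> F \<Longrightarrow> x + y \<in> F" for x y using d[of x "-y"] u by simp
  show "x \<in> F \<Longrightarrow> y \<in> F \<Longrightarrow> x / y \<in> F" using m i by (simp add: divide_inverse)
  show p: "x \<in> F \<Longrightarrow> x ^ n \<in> F" for x n by (induction n) (auto intro: 1 m)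
  show "x \<in> F \<Longrightarrow> x powi k \<in> F" by (auto simp: power_int_def p i)
  show "of_nat m \<in> F" by (induction m) (auto intro: 0 1 a)
qed

text \<open>The degree of \<open>x\<close> over \<open>F\<close> is at most \<open>d\<close>. A
  nontrivial relation between powers, not necessarily monic, is exactly what linear dependence
  provides.\<close>

definition algebraic_le :: "'a::field set \<Rightarrow> nat \<Rightarrow> 'a \<Rightarrow> bool" where
  "algebraic_le F d x \<longleftrightarrow> (\<exists>c. (\<forall>i. c i \<in> F) \<and> (\<exists>i\<le>d. c i \<noteq> 0) \<and> (\<Sum>i\<le>d. c i * x ^ i) = 0)"

context valuation_subring
begin

text \<open>
  The inequality \<open>e \<le> [L : F]\<close> for the ramification index: two terms of an equation satisfied by \<open>x\<close>
  must have the same value.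
\<close>

lemma power_equiv_subfield:
  assumes F: "subfield_set F" and "algebraic_le F d x" "x \<noteq> 0"
  shows "\<exists>s a. 1 \<le> s \<and> s \<le> d \<and> a \<in> F \<and> x ^ s \<asymp> a"
proof -
  obtain c where c: "\<And>i. c i \<in> F" "\<exists>i\<le>d. c i \<noteq> 0" "(\<Sum>i\<le>d. c i * x ^ i) = 0"
    using assms(2) by (auto simp: algebraic_le_def)
  define I where "I = {i. i \<le> d \<and> c i \<noteq> 0}"
  have I: "finite I" "I \<noteq> {}" "\<And>i. i \<in> I \<Longrightarrow> c i * x ^ i \<noteq> 0"
    using c(2) \<open>x \<noteq> 0\<close> by (auto simp: I_def)
  have "(\<Sum>i\<in>I. c i * x ^ i) = (\<Sum>i\<le>d. c i * x ^ i)"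
    by (rule sum.mono_neutral_left) (auto simp: I_def)
  \<comment> \<open>Equivalence holds between nonzero elements only, so the vanishing sum is
    equivalent to none of its terms.\<close>
  hence "\<not> (\<exists>i\<in>I. (\<Sum>i\<in>I. c i * x ^ i) \<asymp> c i * x ^ i)"
    unfolding c(3) by (auto simp: equiv_val_def)
  then obtain i j where "i \<in> I" "j \<in> I" "i \<noteq> j" "c i * x ^ i \<asymp> c j * x ^ j"
    using sum_equiv_term[of I "\<lambda>i. c i * x ^ i", OF I] by blast
  then obtain i j where ij: "i \<in> I" "j \<in> I" "i < j" "c i * x ^ i \<asymp> c j * x ^ j"
    using equiv_sym by (metis nat_neq_iff)
  have nz: "c i \<noteq> 0" "c j \<noteq> 0"
    using ij by (auto simp: I_def)
  have "c i * x ^ i / (c j * x ^ i) \<asymp> c j * x ^ j / (c j * x ^ i)"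
    using ij(4) by (rule equiv_divide) (use nz \<open>x \<noteq> 0\<close> in \<open>auto intro: equiv_refl\<close>)
  hence "c i / c j \<asymp> x ^ (j - i)"
    using nz \<open>x \<noteq> 0\<close> ij(3) by (simp add: power_diff)
  hence "x ^ (j - i) \<asymp> c i / c j"
    by (rule equiv_sym)
  moreover have "c i / c j \<in> F"
    by (intro subfield_setD[OF F] c)
  ultimately show ?thesis
    using ij by (intro exI[of _ "j - i"] exI[of _ "c i / c j"]) (auto simp: I_def)
qed

text \<open>The values of the nonzero elements of \<open>F\<close> form an infinite cyclic group
  generated by the positive value of \<open>\<pi>\<close>.\<close>

definition uniformizer :: "'a set \<Rightarrow> 'a \<Rightarrow> bool" where
  "uniformizer F \<pi> \<longleftrightarrow> \<pi> \<in> F \<and> \<pi> \<noteq> 0 \<and> \<pi> \<in> max_ideal \<and> (\<forall>x\<in>F. x \<noteq> 0 \<longrightarrow> (\<exists>k. x \<asymp> \<pi> powi k))"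

text \<open>Raising to the power \<open>N\<close> sends all values of \<open>F\<close> to integral
  multiples of the value of \<open>p\<close>. The least positive multiple \<open>g\<close> that
  occurs belongs to a generator, as for subgroups of the integers.\<close>

lemma uniformizer_exists:
  assumes F: "subfield_set F" and p: "p \<in> F" "p \<noteq> 0" "p \<in> max_ideal"
    and fin: "\<And>x. x \<in> F \<Longrightarrow> x \<noteq> 0 \<Longrightarrow> \<exists>s k. 1 \<le> s \<and> s \<le> d \<and> x ^ s \<asymp> p powi k"
  shows "\<exists>\<pi>. uniformizer F \<pi>"
proof -
  \<comment> \<open>A common multiple of all the exponents \<open>s \<le> d\<close>.\<close>
  define N :: nat where "N = fact d"
  have N: "N > 0" by (simp add: N_def)
  have val: "\<exists>k. x ^ N \<asymp> p powi k" if x: "x \<in> F" "x \<noteq> 0" for x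
  proof -
    obtain s k where s: "1 \<le> s" "s \<le> d" "x ^ s \<asymp> p powi k"
      using fin[OF x] by blast
    have "s dvd N"
      using s by (simp add: N_def dvd_fact)
    then obtain r where r: "N = s * r" by (auto simp: dvd_def)
    have "(x ^ s) ^ r \<asymp> (p powi k) ^ r"
      using s(3) by (rule equiv_power)
    thus ?thesis
      by (auto simp: r power_mult power_int_power' intro!: exI[of _ "k * int r"])
  qed
  define P where "P = (\<lambda>g::nat. g > 0 \<and> (\<exists>x\<in>F. x \<noteq> 0 \<and> x ^ N \<asymp> p powi (int g)))"
  have "P N"
    unfolding P_def using N p by (auto intro!: bexI[of _ p] equiv_refl)
  define g where "g = (LEAST g. P g)"
  have "P g" and least: "\<And>h. P h \<Longrightarrow> g \<le> h"
    unfolding g_def using \<open>P N\<close> by (auto intro: LeastI Least_le)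
  then obtain \<pi> where pi: "\<pi> \<in> F" "\<pi> \<noteq> 0" "\<pi> ^ N \<asymp> p powi (int g)" and g: "g > 0"
    unfolding P_def by auto
  have "\<pi> ^ N \<in> max_ideal"
    using equiv_max_ideal[OF pi(3)] max_ideal_power[OF p(3) g] by simp
  hence "\<pi> \<in> max_ideal"
    by (rule max_ideal_power_imp)
  moreover have "\<exists>k. x \<asymp> \<pi> powi k" if x: "x \<in> F" "x \<noteq> 0" for x
  proof -
    obtain k where k: "x ^ N \<asymp> p powi k" using val[OF x] by auto
    \<comment> \<open>Euclidean division by \<open>g\<close>: the remainder vanishes by minimality,
      so \<open>y ^ N\<close> is a unit, and torsion-freeness makes \<open>y\<close> a unit.\<close>
    define q where "q = k div int g"
    define y where "y = x / \<pi> powi q"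
    have y: "y \<in> F" "y \<noteq> 0"
      unfolding y_def using x pi by (auto intro!: subfield_setD[OF F])
    have "y ^ N = x ^ N / (\<pi> ^ N) powi q"
      unfolding y_def by (simp add: power_divide power_int_power' power_int_power mult.commute)
    moreover have "x ^ N / (\<pi> ^ N) powi q \<asymp> p powi k / (p powi (int g)) powi q"
      by (intro equiv_divide equiv_power_int k pi)
    moreover have "p powi k / (p powi (int g)) powi q = p powi (k mod int g)"
      using p(2) unfolding q_def
      by (simp add: minus_mult_div_eq_mod del: power_int_of_nat flip: power_int_mult power_int_diff)
    ultimately have yN: "y ^ N \<asymp> p powi (k mod int g)"
      by simp
    have "k mod int g = 0"
    proof (rule ccontr)
      assume "k mod int g \<noteq> 0"
      moreover have b: "k mod int g \<ge> 0" "k mod int g < int g"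
        using g by auto
      ultimately have "P (nat (k mod int g))"
        unfolding P_def using y yN by (auto intro!: bexI[of _ y])
      hence "g \<le> nat (k mod int g)" by (rule least)
      thus False using b by linarith
    qed
    hence "y \<asymp> 1"
      using yN equiv_power_one_imp[OF _ N] by simp
    hence "y * \<pi> powi q \<asymp> 1 * \<pi> powi q"
      by (rule equiv_mult) (use pi in \<open>auto intro: equiv_refl\<close>)
    thus ?thesis
      unfolding y_def using pi(2) by auto
  qed
  ultimately show ?thesis
    using pi by (auto simp: uniformizer_def)
qed

text \<open>The value of \<open>x\<close> is an N-th part of the generator, so only multiples of
  \<open>N\<close> bring it into the value group of \<open>F\<close>.\<close>

lemma dvd_of_power_equiv:
  assumes u: "uniformizer F \<pi>" and x: "x ^ N \<asymp> \<pi>" and a: "x ^ s \<asymp> a" "a \<in> F"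
  shows "N dvd s"
proof -
  have pi: "\<pi> \<in> max_ideal" using u by (simp add: uniformizer_def)
  have "a \<noteq> 0" using a(1) by (simp add: equiv_val_def)
  then obtain j where "a \<asymp> \<pi> powi j"
    using u a(2) by (auto simp: uniformizer_def)
  with a(1) have "x ^ s \<asymp> \<pi> powi j" by (rule equiv_trans)
  hence "(x ^ s) ^ N \<asymp> (\<pi> powi j) ^ N"
    by (rule equiv_power)
  moreover have "(x ^ N) ^ s \<asymp> \<pi> ^ s"
    using x by (rule equiv_power)
  ultimately have "\<pi> ^ s \<asymp> (\<pi> powi j) ^ N"
    unfolding power_mult[symmetric] mult.commute[of N s] by (metis equiv_sym equiv_trans)
  hence "\<pi> powi int s \<asymp> \<pi> powi (j * int N)"
    unfolding power_int_power' power_int_of_nat .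
  hence "int s = j * int N"
    by (rule power_int_equiv_imp_eq[OF pi])
  hence "int N dvd int s"
    by simp
  thus ?thesis
    by (simp only: int_dvd_int_iff)
qed

text \<open>A discrete value group is archimedean: enough copies of the positive value of
  \<open>p\<close> outweigh any value in \<open>F\<close>.\<close>

lemma absorb_power:
  assumes u: "uniformizer F \<pi>" and p: "p \<in> F" "p \<in> max_ideal" "p \<noteq> 0" and x: "x \<in> F"
  shows "\<exists>N0. \<forall>N\<ge>N0. x * p ^ N \<in> max_ideal"
proof (cases "x = 0")
  case True
  thus ?thesis using zero by (auto simp: max_ideal_def)
next
  case False
  have pi: "\<pi> \<in> max_ideal" "\<pi> \<noteq> 0" using u by (auto simp: uniformizer_def)
  obtain k where k: "x \<asymp> \<pi> powi k" using u x False by (auto simp: uniformizer_def)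
  obtain j where j: "p \<asymp> \<pi> powi j" using u p by (auto simp: uniformizer_def)
  have pos: "\<pi> powi i \<in> max_ideal \<longleftrightarrow> i > 0" for i
  proof (cases "i > 0")
    case True
    thus ?thesis using max_ideal_power[OF pi(1), of "nat i"] by (simp add: power_int_def)
  next
    case False
    hence "\<pi> powi (-i) = \<pi> ^ nat (-i)"
      by (intro power_int_nonneg_exp) simp
    hence "inverse (\<pi> powi i) \<in> A"
      using power[OF max_ideal_subset[OF pi(1)], of "nat (-i)"] by (simp add: power_int_minus)
    hence "\<pi> powi i \<notin> max_ideal"
      using pi(2) not_in_max_ideal by simp
    thus ?thesis
      using False by simp
  qed
  have "j > 0"
    using equiv_max_ideal[OF equiv_sym[OF j] p(2)] pos by simp
  have "x * p ^ N \<in> max_ideal" if N: "N \<ge> nat (\<bar>k\<bar> + 1)" for N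
  proof -
    have "x * p ^ N \<asymp> \<pi> powi k * (\<pi> powi j) ^ N"
      by (intro equiv_mult equiv_power k j)
    also have "\<pi> powi k * (\<pi> powi j) ^ N = \<pi> powi (k + j * int N)"
      using pi(2) by (simp add: power_int_add power_int_power')
    finally have "x * p ^ N \<asymp> \<pi> powi (k + j * int N)" .
    moreover have "k + j * int N > 0"
    proof -
      have "1 * int N \<le> j * int N" using \<open>j > 0\<close> by (intro mult_right_mono) auto
      thus ?thesis using N by linarith
    qed
    ultimately show ?thesis
      using equiv_max_ideal pos by simp
  qed
  thus ?thesis by blast
qed

end

section \<open>Existence of valuation rings above a prime\<close>

definition subring_set :: "'a::ring_1 set \<Rightarrow> bool" where
  "subring_set S \<longleftrightarrow> 1 \<in> S \<and> (\<forall>x\<in>S. \<forall>y\<in>S. x - y \<in> S \<and> x * y \<in> S)"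

lemma subring_setD:
  assumes "subring_set S"
  shows "1 \<in> S" "0 \<in> S" "x \<in> S \<Longrightarrow> - x \<in> S" "x \<in> S \<Longrightarrow> y \<in> S \<Longrightarrow> x + y \<in> S"
    "x \<in> S \<Longrightarrow> y \<in> S \<Longrightarrow> x - y \<in> S" "x \<in> S \<Longrightarrow> y \<in> S \<Longrightarrow> x * y \<in> S"
    "x \<in> S \<Longrightarrow> x ^ n \<in> S" "(\<And>i. i \<in> I \<Longrightarrow> f i \<in> S) \<Longrightarrow> sum f I \<in> S" "of_int k \<in> S"
proof -
  show 1: "1 \<in> S" and d: "x \<in> S \<Longrightarrow> y \<in> S \<Longrightarrow> x - y \<in> S" and m: "x \<in> S \<Longrightarrow> y \<in> S \<Longrightarrow> x * y \<in> S"
    for x y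
    using assms by (auto simp: subring_set_def)
  show 0: "0 \<in> S" using d[OF 1 1] by simp
  show u: "x \<in> S \<Longrightarrow> - x \<in> S" for x using d[OF 0] by simp
  show a: "x \<in> S \<Longrightarrow> y \<in> S \<Longrightarrow> x + y \<in> S" for x y using d[of x "-y"] u by simp
  show "x \<in> S \<Longrightarrow> x ^ n \<in> S" for x n by (induction n) (auto intro: 1 m)
  show "(\<And>i. i \<in> I \<Longrightarrow> f i \<in> S) \<Longrightarrow> sum f I \<in> S"
    by (induction I rule: infinite_finite_induct) (auto intro: 0 a)
  show "of_int k \<in> S"
    by (induction k rule: int_induct[where k = 0]) (auto intro: 0 1 a d)
qed

definition adjoin :: "'a::comm_ring_1 set \<Rightarrow> 'a \<Rightarrow> 'a set" where
  "adjoin S x = {poly f x |f. \<forall>i. Polynomial.coeff f i \<in> S}"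

lemma subring_set_adjoin:
  assumes "subring_set S"
  shows "subring_set (adjoin S x)" "S \<subseteq> adjoin S x" "x \<in> adjoin S x"
proof -
  have poly_in: "poly f x \<in> adjoin S x" if "\<forall>i. Polynomial.coeff f i \<in> S" for f
    using that by (auto simp: adjoin_def)
  have const: "\<forall>i. Polynomial.coeff [:s:] i \<in> S" if "s \<in> S" for s
    using that subring_setD(2)[OF assms] by (auto simp: coeff_pCons split: nat.splits)
  show "S \<subseteq> adjoin S x"
    using poly_in[OF const] by auto
  thus "subring_set (adjoin S x)"
    unfolding subring_set_def
  proof (intro conjI ballI)
    fix y z assume "y \<in> adjoin S x" "z \<in> adjoin S x"
    then obtain f g where f: "y = poly f x" "\<forall>i. Polynomial.coeff f i \<in> S" and g: "z = poly g x" "\<forall>i. Polynomial.coeff g i \<in> S"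
      by (auto simp: adjoin_def)
    have "\<forall>i. Polynomial.coeff (f - g) i \<in> S"
      using f g subring_setD(5)[OF assms] by simp
    thus "y - z \<in> adjoin S x"
      using poly_in[of "f - g"] f g by simp
    have "\<forall>i. Polynomial.coeff (f * g) i \<in> S"
      unfolding coeff_mult using f g by (auto intro!: subring_setD[OF assms])
    thus "y * z \<in> adjoin S x"
      using poly_in[of "f * g"] f g by simp
  qed (use subring_setD(1)[OF assms] in auto)
  have "\<forall>i. Polynomial.coeff [:0, 1:] i \<in> S"
    using subring_setD(1,2)[OF assms] by (auto simp: coeff_pCons split: nat.splits)
  thus "x \<in> adjoin S x"
    using poly_in[of "[:0, 1:]"] by simp
qed

text \<open>
  Chevalley's extension theorem: a subring that is maximal among those not containing \<open>1 / p\<close> is a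
  valuation ring.
\<close>

lemma valuation_subring_of_maximal:
  fixes M :: "'a::field set"
  assumes M: "subring_set M" "p \<in> M" "inverse p \<notin> M"
    and max: "\<And>S. subring_set S \<Longrightarrow> M \<subseteq> S \<Longrightarrow> inverse p \<notin> S \<Longrightarrow> S = M"
  shows "valuation_subring M" "p \<in> valuation_subring.max_ideal M"
proof -
  note Mc = subring_setD[OF M(1)]
  have p: "p \<noteq> 0"
    using M Mc(2) by auto
  \<comment> \<open>By maximality, adjoining any element outside \<open>M\<close> produces
    \<open>inverse p\<close>.\<close>
  have adj: "\<exists>f. (\<forall>i. Polynomial.coeff f i \<in> M) \<and> poly f x = inverse p" if "x \<notin> M" for x
  proof -
    have "adjoin M x \<noteq> M"
      using subring_set_adjoin(3)[OF M(1), of x] that by auto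
    hence "inverse p \<in> adjoin M x"
      using max subring_set_adjoin(1,2)[OF M(1), of x] by blast
    thus ?thesis
      by (auto simp: adjoin_def)
  qed
  \<comment> \<open>Otherwise \<open>inverse p\<close> is a polynomial in \<open>y\<close>. Clearing
    denominators gives \<open>(1 - p * r) ^ n = p * s\<close>, while expansion gives
    \<open>1 - p * t\<close>; comparing the two puts \<open>inverse p\<close> into
    \<open>M\<close>.\<close>
  have unit: "inverse (1 - p * r) \<in> M" if r: "r \<in> M" for r
  proof (rule ccontr)
    define y where "y = inverse (1 - p * r)"
    assume "inverse (1 - p * r) \<notin> M"
    then obtain f where f: "\<And>i. Polynomial.coeff f i \<in> M" "poly f y = inverse p"
      using adj by (auto simp: y_def)
    have "1 - p * r \<noteq> 0"
    proof
      assume "1 - p * r = 0"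
      hence "r = inverse p"
        using p by (simp add: field_simps)
      thus False using r M(3) by simp
    qed
    hence y: "(1 - p * r) * y = 1"
      by (simp add: y_def)
    define n where "n = Polynomial.degree f"
    define s where "s = (\<Sum>i\<le>n. Polynomial.coeff f i * (1 - p * r) ^ (n - i))"
    have s: "s \<in> M"
      unfolding s_def by (intro Mc f r M)
    have "(1 - p * r) ^ n * inverse p = (\<Sum>i\<le>n. Polynomial.coeff f i * ((1 - p * r) ^ n * y ^ i))"
      unfolding f(2)[symmetric] poly_altdef n_def by (simp add: sum_distrib_left mult_ac)
    also have "\<dots> = s"
      unfolding s_def
    proof (intro sum.cong refl)
      fix i assume "i \<in> {..n}"
      hence "(1 - p * r) ^ n = (1 - p * r) ^ (n - i) * (1 - p * r) ^ i"
        by (simp flip: power_add)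
      hence "(1 - p * r) ^ n * y ^ i = (1 - p * r) ^ (n - i) * ((1 - p * r) * y) ^ i"
        by (simp add: power_mult_distrib mult.assoc)
      thus "Polynomial.coeff f i * ((1 - p * r) ^ n * y ^ i) = Polynomial.coeff f i * (1 - p * r) ^ (n - i)"
        using y by simp
    qed
    finally have eq: "(1 - p * r) ^ n = p * s"
      using p by (simp add: field_simps)
    have "\<exists>t\<in>M. (1 - p * r) ^ n = 1 - p * t"
    proof (induction n)
      case 0
      thus ?case using Mc(2) by auto
    next
      case (Suc n)
      then obtain t where t: "t \<in> M" "(1 - p * r) ^ n = 1 - p * t" by auto
      have "(1 - p * r) ^ Suc n = 1 - p * (t + r - p * r * t)"
        by (simp add: t(2) algebra_simps)
      moreover have "t + r - p * r * t \<in> M"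
        by (intro Mc t r M)
      ultimately show ?case by blast
    qed
    then obtain t where "t \<in> M" "1 - p * t = p * s"
      using eq by auto
    moreover from this(2) have "inverse p = s + t"
      using p by (simp add: field_simps)
    ultimately show False
      using M(3) s Mc(4) by auto
  qed
  \<comment> \<open>The relation says that 1 is a polynomial in \<open>x\<close> of degree at most
    \<open>n\<close> with coefficients in the ideal \<open>p M\<close>.\<close>
  define P where "P = (\<lambda>x n. \<exists>c. (\<forall>i. c i \<in> M) \<and> (\<Sum>i\<le>n. p * c i * x ^ i) = 1)"
  have P_mono: "P x n" if "P x m" "m \<le> n" for x m n
  proof -
    obtain c where c: "\<And>i. c i \<in> M" "(\<Sum>i\<le>m. p * c i * x ^ i) = 1"
      using \<open>P x m\<close> by (auto simp: P_def)
    define c' where "c' = (\<lambda>i. if i \<le> m then c i else 0)"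
    have "(\<Sum>i\<le>n. p * c' i * x ^ i) = (\<Sum>i\<le>m. p * c' i * x ^ i)"
      by (rule sum.mono_neutral_right) (use that(2) in \<open>auto simp: c'_def\<close>)
    also have "\<dots> = 1"
      using c(2) by (simp add: c'_def)
    finally show ?thesis
      unfolding P_def using c(1) Mc(2) by (intro exI[of _ c']) (auto simp: c'_def)
  qed
  have ex: "\<exists>n. P x n" if xM: "x \<notin> M" for x
  proof -
    obtain f where f: "\<And>i. Polynomial.coeff f i \<in> M" "poly f x = inverse p"
      using adj[OF xM] by auto
    have "(\<Sum>i\<le>Polynomial.degree f. p * Polynomial.coeff f i * x ^ i) = p * poly f x"
      by (simp add: poly_altdef sum_distrib_left mult.assoc)
    thus ?thesis
      unfolding P_def using f p by (intro exI[of _ "Polynomial.degree f"] exI[of _ "Polynomial.coeff f"]) simp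
  qed
  \<comment> \<open>In the relation for \<open>inverse x\<close> the constant term is moved to the
    other side, where \<open>1 - p * g 0\<close> is a unit of \<open>M\<close>. Multiplying by
    \<open>x ^ Suc n\<close> expresses this power by lower ones, and substitution lowers the degree
    of the relation for \<open>x\<close>.\<close>
  have reduce: "P x n" if P: "P x (Suc n)" "P (inverse x) (Suc n)" and x: "x \<noteq> 0" for x n
  proof -
    obtain c where c: "\<And>i. c i \<in> M" "(\<Sum>i\<le>Suc n. p * c i * x ^ i) = 1"
      using P(1) by (auto simp: P_def)
    obtain g where g: "\<And>i. g i \<in> M" "(\<Sum>i\<le>Suc n. p * g i * inverse x ^ i) = 1"
      using P(2) by (auto simp: P_def)
    define u where "u = inverse (1 - p * g 0)"
    have u: "u \<in> M"
      unfolding u_def by (rule unit) (rule g)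
    have "1 - p * g 0 \<noteq> 0"
    proof
      assume "1 - p * g 0 = 0"
      hence "inverse p = g 0"
        using p by (simp add: field_simps)
      thus False using g(1) M(3) by metis
    qed
    hence u1: "u * (1 - p * g 0) = 1"
      by (simp add: u_def)
    have "(\<Sum>i\<le>Suc n. p * g i * inverse x ^ i) = p * g 0 + (\<Sum>i\<le>n. p * g (Suc i) * inverse x ^ Suc i)"
      using sum.atMost_Suc_shift[of "\<lambda>i. p * g i * inverse x ^ i" n] by simp
    hence "(\<Sum>i\<le>n. p * g (Suc i) * inverse x ^ Suc i) = 1 - p * g 0"
      using g(2) by (simp add: algebra_simps)
    hence "x ^ Suc n * u * (\<Sum>i\<le>n. p * g (Suc i) * inverse x ^ Suc i) = x ^ Suc n"
      using u1 by (simp add: mult.assoc)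
    hence "x ^ Suc n = (\<Sum>i\<le>n. p * (u * g (Suc i)) * (x ^ Suc n * inverse x ^ Suc i))"
      by (simp add: sum_distrib_left mult_ac)
    also have "\<dots> = (\<Sum>i\<le>n. p * (u * g (Suc i)) * x ^ (n - i))"
    proof (intro sum.cong refl)
      fix i assume "i \<in> {..n}"
      hence "x ^ Suc n = x ^ (n - i) * x ^ Suc i"
        by (simp flip: power_add)
      moreover have "x ^ Suc i * inverse x ^ Suc i = 1"
        unfolding power_mult_distrib[symmetric] using x by simp
      ultimately have "x ^ Suc n * inverse x ^ Suc i = x ^ (n - i)"
        by (metis mult.assoc mult_1_right)
      thus "p * (u * g (Suc i)) * (x ^ Suc n * inverse x ^ Suc i) = p * (u * g (Suc i)) * x ^ (n - i)"
        by simp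
    qed
    also have "\<dots> = (\<Sum>i\<le>n. p * (u * g (Suc (n - i))) * x ^ i)"
      by (rule sum.reindex_bij_witness[of _ "\<lambda>i. n - i" "\<lambda>i. n - i"]) auto
    finally have top: "x ^ Suc n = (\<Sum>i\<le>n. p * (u * g (Suc (n - i))) * x ^ i)" .
    have "1 = (\<Sum>i\<le>n. p * c i * x ^ i) + p * c (Suc n) * x ^ Suc n"
      using c(2) by simp
    also have "\<dots> = (\<Sum>i\<le>n. p * (c i + p * c (Suc n) * u * g (Suc (n - i))) * x ^ i)"
      unfolding top by (simp add: sum_distrib_left sum.distrib[symmetric] algebra_simps)
    finally show ?thesis
      unfolding P_def
      by (intro exI[of _ "\<lambda>i. c i + p * c (Suc n) * u * g (Suc (n - i))"])
        (use c(1) g(1) u M(2) in \<open>auto intro!: Mc\<close>)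
  qed
  \<comment> \<open>Both relations descend simultaneously; in degree zero they would put
    \<open>inverse p\<close> into \<open>M\<close>.\<close>
  have no: "\<not> (P x n \<and> P (inverse x) n)" if "x \<noteq> 0" for x n
  proof (induction n)
    case 0
    have "\<not> P x 0"
    proof
      assume "P x 0"
      then obtain c where "c \<in> M" "p * c = 1"
        by (auto simp: P_def)
      moreover from this have "c = inverse p"
        using p by (simp add: field_simps)
      ultimately show False using M(3) by simp
    qed
    thus ?case by simp
  next
    case (Suc n)
    thus ?case
      using reduce[of x n] reduce[of "inverse x" n] that by auto
  qed
  show val: "valuation_subring M"
  proof
    fix x
    show "x \<in> M \<or> inverse x \<in> M"
    proof (rule ccontr)
      assume neg: "\<not> ?thesis"
      then obtain m n where "P x m" "P (inverse x) n"
        using ex by metis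
      \<comment> \<open>Padding to a common degree makes the symmetric descent applicable.\<close>
      hence "P x (max m n)" "P (inverse x) (max m n)"
        by (auto intro: P_mono)
      moreover have "x \<noteq> 0"
        using neg Mc(2) by auto
      ultimately show False
        using no by blast
    qed
  qed (use Mc in auto)
  show "p \<in> valuation_subring.max_ideal M"
    using M by (simp add: valuation_subring.max_ideal_def[OF val])
qed

text \<open>Zorn's lemma yields a maximal subring above \<open>R\<close> without
  \<open>inverse p\<close>, because the union of a nonempty chain of such subrings is again
  one.\<close>

lemma chevalley:
  fixes R :: "'a::field set"
  assumes R: "subring_set R" "p \<in> R" "inverse p \<notin> R"
  shows "\<exists>M. valuation_subring M \<and> R \<subseteq> M \<and> p \<in> valuation_subring.max_ideal M"
proof -
  define \<S> where "\<S> = {S. subring_set S \<and> R \<subseteq> S \<and> inverse p \<notin> S}"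
  have "\<S> \<noteq> {}" using R by (auto simp: \<S>_def)
  moreover have "\<Union>C \<in> \<S>" if C: "C \<noteq> {}" "subset.chain \<S> C" for C
  proof -
    have sub: "C \<subseteq> \<S>" and lin: "\<And>S T. S \<in> C \<Longrightarrow> T \<in> C \<Longrightarrow> S \<subseteq> T \<or> T \<subseteq> S"
      using C(2) by (auto simp: subset.chain_def)
    have "subring_set (\<Union>C)"
      unfolding subring_set_def
    proof (intro conjI ballI)
      show "1 \<in> \<Union>C"
        using C(1) sub by (auto simp: \<S>_def subring_set_def)
      fix x y assume "x \<in> \<Union>C" "y \<in> \<Union>C"
      then obtain S T where "S \<in> C" "x \<in> S" "T \<in> C" "y \<in> T" by auto
      then obtain S where S: "S \<in> C" "x \<in> S" "y \<in> S"
        using lin[of S T] by auto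
      hence "subring_set S" using sub by (auto simp: \<S>_def)
      thus "x - y \<in> \<Union>C" "x * y \<in> \<Union>C"
        using S subring_setD(5,6) by blast+
    qed
    thus ?thesis
      using C(1) sub by (auto simp: \<S>_def)
  qed
  ultimately obtain M where M: "M \<in> \<S>" "\<And>S. S \<in> \<S> \<Longrightarrow> M \<subseteq> S \<Longrightarrow> S = M"
    using subset_Zorn_nonempty[of \<S>] by auto
  have "valuation_subring M \<and> p \<in> valuation_subring.max_ideal M"
    using M R(2) by (intro conjI valuation_subring_of_maximal) (auto simp: \<S>_def)
  thus ?thesis
    using M(1) by (auto simp: \<S>_def)
qed

lemma prime_valuation_subring:
  fixes p :: nat
  assumes "Factorial_Ring.prime p"
  shows "\<exists>M :: 'a::field_char_0 set. valuation_subring M \<and> of_nat p \<in> valuation_subring.max_ideal M"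
proof -
  have "subring_set (\<int> :: 'a set)"
    by (auto simp: subring_set_def)
  moreover have "inverse (of_nat p) \<notin> (\<int> :: 'a set)"
  proof
    assume "inverse (of_nat p) \<in> (\<int> :: 'a set)"
    then obtain k where "inverse (of_nat p) = (of_int k :: 'a)"
      by (auto elim: Ints_cases)
    hence "of_int (k * int p) = (of_int 1 :: 'a)"
      using assms prime_gt_0_nat[of p] by (simp add: field_simps)
    hence "k * int p = 1"
      by (simp only: of_int_eq_iff)
    hence "int p dvd 1"
      by (metis dvd_triv_right)
    thus False
      using assms by simp
  qed
  ultimately show ?thesis
    using chevalley[of "\<int> :: 'a set" "of_nat p"] by auto
qed

section \<open>Values of rational numbers and roots of positive value\<close>

context valuation_subring
begin

lemma of_int_mem: "of_int k \<in> A"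
proof -
  have "subring_set A"
    unfolding subring_set_def using one diff mult by auto
  thus ?thesis by (rule subring_setD)
qed

text \<open>A Bezout relation makes a multiple of \<open>n\<close> congruent to 1 modulo the maximal
  ideal.\<close>

lemma of_int_equiv_one:
  assumes p: "of_nat p \<in> max_ideal" and "coprime n (int p)"
  shows "of_int n \<asymp> 1"
proof -
  obtain a b where "a * n + b * int p = 1"
    using bezout_int[of n "int p"] assms(2) by auto
  hence "of_int (a * n + b * int p) = (1 :: 'a)"
    by simp
  hence "of_int a * of_int n = (1 + - (of_int b * of_nat p) :: 'a)"
    by (simp add: algebra_simps)
  hence "of_int a * of_int n \<asymp> 1"
    using one_plus_equiv[OF max_ideal_uminus[OF max_ideal_mult[OF of_int_mem p]]] by metis
  hence "of_int n \<notin> max_ideal"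
    using max_ideal_mult[OF of_int_mem, of "of_int n" a] equiv_one_iff by auto
  thus ?thesis
    using of_int_mem equiv_one_iff by auto
qed

end

text \<open>On the rationals this is the p-adic valuation: what remains after splitting off powers
  of \<open>p\<close> is a unit. The assumption \<open>char\<close> supplies characteristic zero, as
  the locale only fixes a field.\<close>

lemma (in valuation_subring) rat_equiv_power_int:
  assumes char: "\<And>k. (of_int k :: 'a) = 0 \<longleftrightarrow> k = 0"
    and p: "Factorial_Ring.prime p" "of_nat p \<in> max_ideal" and ab: "a \<noteq> 0" "b \<noteq> 0"
  shows "\<exists>k. of_int a / of_int b \<asymp> of_nat p powi k"
proof -
  have *: "\<exists>k. of_int a \<asymp> (of_nat p :: 'a) powi k" if "a \<noteq> 0" for a
  proof -
    define m where "m = multiplicity (int p) a"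
    have "\<not> is_unit (int p)"
      using p(1) by auto
    then obtain c where c: "a = int p ^ m * c" "\<not> int p dvd c"
      unfolding m_def by (rule multiplicity_decompose'[OF \<open>a \<noteq> 0\<close>])
    have "coprime c (int p)"
      using c(2) p(1) prime_imp_coprime[of "int p" c] by (simp add: coprime_commute)
    hence "of_int c \<asymp> 1"
      by (rule of_int_equiv_one[OF p(2)])
    moreover have "(of_nat p :: 'a) \<noteq> 0"
      using char[of "int p"] p(1) by auto
    ultimately have "of_nat p ^ m * of_int c \<asymp> of_nat p ^ m * 1"
      by (intro equiv_mult equiv_refl) auto
    hence "of_int a \<asymp> of_nat p powi int m"
      unfolding c(1) by simp
    thus ?thesis by blast
  qed
  obtain k l where "of_int a \<asymp> of_nat p powi k" "of_int b \<asymp> of_nat p powi l"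
    using * ab by metis
  hence "of_int a / of_int b \<asymp> of_nat p powi k / of_nat p powi l"
    by (rule equiv_divide)
  moreover have "(of_nat p :: 'a) \<noteq> 0"
    using char[of "int p"] p(1) by auto
  ultimately show ?thesis
    by (metis power_int_diff)
qed

text \<open>Up to sign the constant term is the product of the roots, and the maximal ideal is
  prime. In the induction, a root outside the ideal has its inverse in \<open>A\<close>, so dividing
  it out keeps the constant term in the ideal.\<close>

lemma root_in_max_ideal:
  fixes f :: "complex poly"
  assumes "valuation_subring A" "Polynomial.lead_coeff f = 1" "Polynomial.coeff f 0 \<in> valuation_subring.max_ideal A"
  shows "\<exists>z\<in>valuation_subring.max_ideal A. poly f z = 0"
  using assms(2,3)
proof (induction "Polynomial.degree f" arbitrary: f)
  interpret valuation_subring A by fact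
  case 0
  hence "Polynomial.coeff f 0 = 1" by simp
  thus ?case using 0 one_notin_max_ideal by simp
next
  interpret valuation_subring A by fact
  case (Suc n)
  have "\<not> constant (poly f)"
    using Suc.hyps(2) by (simp add: constant_degree)
  then obtain z where z: "poly f z = 0"
    using fundamental_theorem_of_algebra by blast
  then obtain g where g: "f = [:-z, 1:] * g"
    by (auto simp: poly_eq_0_iff_dvd dvd_def)
  have "g \<noteq> 0" using Suc.hyps(2) g by auto
  show ?case
  proof (cases "z \<in> max_ideal")
    case False
    have "Polynomial.degree f = Suc (Polynomial.degree g)"
      unfolding g using \<open>g \<noteq> 0\<close> by (subst degree_mult_eq) auto
    hence "n = Polynomial.degree g" using Suc.hyps(2) by simp
    moreover have "Polynomial.lead_coeff g = 1"
      using Suc.prems(1) unfolding g lead_coeff_mult by simp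
    moreover have "Polynomial.coeff f 0 = - z * Polynomial.coeff g 0"
      unfolding g by (simp add: coeff_mult_0)
    hence "Polynomial.coeff g 0 = inverse (- z) * Polynomial.coeff f 0"
      using False by (simp add: not_in_max_ideal)
    hence "Polynomial.coeff g 0 \<in> max_ideal"
      using False Suc.prems(2) uminus by (auto simp: not_in_max_ideal intro!: max_ideal_mult max_ideal_uminus)
    ultimately obtain w where "w \<in> max_ideal" "poly g w = 0"
      using Suc.hyps(1) by blast
    thus ?thesis
      unfolding g by auto
  qed (use z in auto)
qed

section \<open>Newton polygons and intermediate fields\<close>

lemma subfield_set_Rats: "subfield_set (\<rat> :: 'a::field_char_0 set)"
  by (auto simp: subfield_set_def)

text \<open>Bounded degree over \<rat> bounds the ramification: some power \<open>x ^ s\<close> with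
  \<open>s \<le> d\<close> has the value of a rational number, hence of a power of
  \<open>p\<close>.\<close>

lemma number_field_uniformizer:
  fixes F :: "'a::field_char_0 set"
  assumes A: "valuation_subring A" and F: "subfield_set F" and fin: "\<And>x. x \<in> F \<Longrightarrow> algebraic_le \<rat> d x"
    and p: "Factorial_Ring.prime p" "of_nat p \<in> valuation_subring.max_ideal A"
  shows "\<exists>\<pi>. valuation_subring.uniformizer A F \<pi>"
proof -
  interpret valuation_subring A by fact
  show ?thesis
  proof (rule uniformizer_exists[OF F])
    show "of_nat p \<in> F" "of_nat p \<noteq> (0::'a)" "of_nat p \<in> max_ideal"
      using p subfield_setD(11)[OF F] by auto
    fix x assume x: "x \<in> F" "x \<noteq> 0"
    obtain s a where s: "1 \<le> s" "s \<le> d" "a \<in> \<rat>" "x ^ s \<asymp> a"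
      using power_equiv_subfield[OF subfield_set_Rats fin[OF x(1)] x(2)] by blast
    obtain u v :: int where uv: "a = of_int u / of_int v" "v \<noteq> 0"
      using s(3) by (metis Rats_cases' less_numeral_extra(3))
    have "u \<noteq> 0"
      using s(4) uv by (auto simp: equiv_val_def)
    then obtain k where "a \<asymp> of_nat p powi k"
      using rat_equiv_power_int[OF _ p, of u v] uv by auto
    thus "\<exists>s k. 1 \<le> s \<and> s \<le> d \<and> x ^ s \<asymp> of_nat p powi k"
      using s equiv_trans by blast
  qed
qed

text \<open>
  Here the roots of \<open>x\<^sup>n + 4 x\<^sup>n\<^sup>-\<^sup>1 + b\<close> all have value \<open>v(\<pi>) / n\<close>: above \<open>2\<close>, the polynomial is Eisenstein.
\<close>

lemma eisenstein_root:
  fixes \<alpha> b \<pi> :: "'a::field_char_0"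
  assumes A: "valuation_subring A" and "valuation_subring.uniformizer A F \<pi>" and F: "subfield_set F"
    and two: "2 \<in> valuation_subring.max_ideal A" and b: "valuation_subring.equiv_val A b \<pi>"
    and root: "\<alpha> ^ n + 4 * \<alpha> ^ (n - 1) + b = 0" and n: "n \<ge> 2"
  shows "valuation_subring.equiv_val A (\<alpha> ^ n) \<pi>"
proof -
  interpret valuation_subring A by fact
  have pi: "\<pi> \<noteq> 0" "\<pi> \<in> max_ideal" and unif: "\<And>x. x \<in> F \<Longrightarrow> x \<noteq> 0 \<Longrightarrow> \<exists>k. x \<asymp> \<pi> powi k"
    using assms(2) by (auto simp: uniformizer_def)
  obtain k where k: "2 \<asymp> \<pi> powi k"
    using unif[of 2] subfield_setD(11)[OF F, of 2] by auto
  have "k > 0"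
  proof (rule ccontr)
    assume "\<not> k > 0"
    hence "inverse (\<pi> powi k) \<in> A"
      using power[OF max_ideal_subset[OF pi(2)], of "nat (-k)"] power_int_nonneg_exp[of "-k" \<pi>]
      by (simp add: power_int_minus)
    hence "\<pi> powi k \<notin> max_ideal"
      using pi(1) not_in_max_ideal by auto
    thus False
      using equiv_max_ideal[OF equiv_sym[OF k] two] by simp
  qed
  have "\<pi> powi k / \<pi> = \<pi> powi (k - 1)"
    using pi(1) by (simp add: power_int_diff)
  also have "\<dots> \<in> A"
    using \<open>k > 0\<close> power[OF max_ideal_subset[OF pi(2)]] by (simp add: power_int_nonneg_exp)
  finally have "2 / (\<pi> powi k) * (\<pi> powi k / \<pi>) \<in> A"
    using k by (intro mult) (auto simp: equiv_val_def)
  \<comment> \<open>Of the two factors of the coefficient 4, one absorbs the division by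
    \<open>\<pi>\<close> and the other remains in the maximal ideal.\<close>
  hence "2 / \<pi> * 2 \<in> max_ideal"
    using pi(1) two by (intro max_ideal_mult) auto
  hence four: "4 / \<pi> \<in> max_ideal"
    by simp
  hence four': "4 \<in> max_ideal"
    using max_ideal_mult[OF max_ideal_subset[OF pi(2)], of "4 / \<pi>"] pi(1) by simp
  have bm: "b \<in> max_ideal"
    using equiv_max_ideal[OF b pi(2)] .
  \<comment> \<open>Otherwise division of the equation by \<open>\<alpha> ^ n\<close> leaves 1 plus
    an element of the maximal ideal, which cannot vanish.\<close>
  have "\<alpha> \<in> A"
  proof (rule ccontr)
    assume "\<alpha> \<notin> A"
    hence inv: "inverse \<alpha> \<in> max_ideal" "\<alpha> \<noteq> 0"
      using inverse_in_max_ideal zero by auto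
    have "(\<alpha> ^ n + 4 * \<alpha> ^ (n - 1) + b) * inverse \<alpha> ^ n = 1 + (4 * inverse \<alpha> + b * inverse \<alpha> ^ n)"
      using n inv(2) by (simp add: field_simps power_eq_if[of \<alpha> n])
    moreover have "4 * inverse \<alpha> + b * inverse \<alpha> ^ n \<in> max_ideal"
      using inv bm four' n
      by (intro max_ideal_add max_ideal_mult max_ideal_power) (auto intro: max_ideal_subset)
    ultimately show False
      using one_plus_equiv root by (auto simp: equiv_val_def)
  qed
  have "b / \<pi> \<asymp> 1"
    using equiv_divide[OF b equiv_refl[OF pi(1)]] pi(1) by simp
  moreover have "\<alpha> ^ (n - 1) * (4 / \<pi>) \<in> max_ideal"
    by (intro max_ideal_mult power \<open>\<alpha> \<in> A\<close> four)
  ultimately have "b / \<pi> + \<alpha> ^ (n - 1) * (4 / \<pi>) \<asymp> 1"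
    by (rule add_max_ideal_equiv)
  hence "- \<pi> * (b / \<pi> + \<alpha> ^ (n - 1) * (4 / \<pi>)) \<asymp> \<pi> * 1"
    using pi(1) uminus[OF one] by (intro equiv_mult) (auto simp: equiv_val_def)
  moreover have "- \<pi> * (b / \<pi> + \<alpha> ^ (n - 1) * (4 / \<pi>)) = - (b + 4 * \<alpha> ^ (n - 1))"
    using pi(1) by (simp add: distrib_left)
  moreover have "\<alpha> ^ n = - (b + 4 * \<alpha> ^ (n - 1))"
    using root by (metis add.assoc add.commute eq_neg_iff_add_eq_0)
  ultimately show ?thesis by simp
qed

text \<open>
  Above \<open>3\<close>, the Newton polygon has one further root, of value \<open>0\<close>, and \<open>n - 1\<close> roots of value
  \<open>v(\<pi>) / (n - 1)\<close>.
\<close>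

lemma tame_root:
  fixes \<alpha> b :: "'a::field_char_0"
  assumes A: "valuation_subring A"
    and three: "3 \<in> valuation_subring.max_ideal A" and \<alpha>: "\<alpha> \<in> valuation_subring.max_ideal A"
    and root: "\<alpha> ^ n + 4 * \<alpha> ^ (n - 1) + b = 0" and n: "n \<ge> 2" and b: "b \<noteq> 0"
  shows "valuation_subring.equiv_val A (\<alpha> ^ (n - 1)) b"
proof -
  interpret valuation_subring A by fact
  have "coprime 4 (int 3)"
    by (simp add: coprime_iff_gcd_eq_1 gcd_non_0_int)
  hence "4 \<asymp> 1"
    using of_int_equiv_one[of 3 4] three by simp
  hence "4 + \<alpha> \<asymp> 1"
    using \<alpha> by (rule add_max_ideal_equiv)
  \<comment> \<open>The unit \<open>4 + \<alpha>\<close> splits off, so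
    \<open>\<alpha> ^ (n - 1)\<close> has the value of \<open>b\<close>.\<close>
  have eq: "\<alpha> ^ (n - 1) * (4 + \<alpha>) = - b"
    using root n power_eq_if[of \<alpha> n] by (simp add: algebra_simps eq_neg_iff_add_eq_0)
  hence "\<alpha> ^ (n - 1) \<noteq> 0"
    using b n by (auto simp: power_0_left)
  hence "\<alpha> ^ (n - 1) * (4 + \<alpha>) \<asymp> \<alpha> ^ (n - 1) * 1"
    by (intro equiv_mult equiv_refl \<open>4 + \<alpha> \<asymp> 1\<close>)
  hence "\<alpha> ^ (n - 1) \<asymp> -b"
    unfolding eq by (simp add: equiv_sym)
  thus ?thesis
    using equiv_trans[of "\<alpha> ^ (n - 1)" "-b" b] b uminus[OF one] by (auto simp: equiv_val_def)
qed

section \<open>The generator and the degrees below it\<close>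

text \<open>If \<open>e\<close> and \<open>m\<close> are at least 2, then s t \<le> n < 2 (n - 1),
  so s t = n - 1. For \<open>s = e\<close> this makes \<open>e\<close> divide both n and n - 1; for
  \<open>s < e\<close> it contradicts s t \<le> n - m.\<close>

lemma intermediate_degrees_trivial:
  fixes n e m s t :: nat
  assumes "e * m = n" "s \<le> e" "t \<le> m" "1 \<le> s" "1 \<le> t" "n - 1 dvd s * t"
  shows "e = 1 \<or> m = 1"
proof (rule ccontr)
  assume "\<not> ?thesis"
  hence em: "e \<ge> 2" "m \<ge> 2"
    using assms by (auto simp: numeral_2_eq_2 Suc_le_eq)
  have "2 * m \<le> e * m" "e * 2 \<le> e * m"
    using em by (auto intro: mult_le_mono)
  hence n: "n \<ge> 4" "2 * m \<le> n"
    using assms(1) em by linarith+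
  have st: "s * t \<le> n" "1 \<le> s * t"
    using assms mult_le_mono[of s e t m] by auto
  obtain q where q: "s * t = (n - 1) * q"
    using assms(6) by (auto simp: dvd_def)
  have "q = 1"
  proof (rule ccontr)
    assume "q \<noteq> 1"
    hence "q \<ge> 2"
      using q st(2) by (cases q) auto
    hence "(n - 1) * 2 \<le> s * t"
      unfolding q by (intro mult_le_mono) auto
    thus False
      using st n by linarith
  qed
  hence eq: "s * t = n - 1"
    using q by simp
  show False
  proof (cases "s = e")
    case True
    hence "e dvd n - 1" "e dvd n"
      using eq assms(1) by (metis dvd_triv_left)+
    hence "e dvd n - (n - 1)"
      by (rule dvd_diff_nat[rotated])
    thus False
      using n em by auto
  next
    case False
    hence "s * t \<le> (e - 1) * m"
      using assms by (intro mult_le_mono) auto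
    also have "\<dots> = n - m"
      using assms(1) by (simp add: diff_mult_distrib)
    finally show False
      using eq em n by linarith
  qed
qed

text \<open>Degrees enter through \<open>algebraic_le\<close> only, so the argument needs nothing
  but values. With e = [F(\<alpha>) : M] and m = [M : F], the last clause excludes proper
  intermediate fields.\<close>

theorem primitive_algebraic_number:
  fixes F :: "complex set"
  assumes F: "subfield_set F" and fin: "\<And>x. x \<in> F \<Longrightarrow> algebraic_le \<rat> d x" and n: "n \<ge> 2"
  shows "\<exists>\<alpha> b. b \<in> F \<and> \<alpha> ^ n + 4 * \<alpha> ^ (n - 1) + b = 0 \<and>
    (\<forall>e. algebraic_le F e \<alpha> \<longrightarrow> n \<le> e) \<and>
    (\<forall>M e m. subfield_set M \<longrightarrow> algebraic_le M e \<alpha> \<longrightarrow> (\<forall>x\<in>M. algebraic_le F m x) \<longrightarrow>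
       e * m = n \<longrightarrow> e = 1 \<or> m = 1)"
proof -
  obtain A B :: "complex set" where A: "valuation_subring A" "of_nat 2 \<in> valuation_subring.max_ideal A"
    and B: "valuation_subring B" "of_nat 3 \<in> valuation_subring.max_ideal B"
    using prime_valuation_subring[OF two_is_prime_nat, where ?'a = complex]
      prime_valuation_subring[of 3, where ?'a = complex] by auto
  interpret A: valuation_subring A by fact
  interpret B: valuation_subring B by fact
  obtain \<pi> where pi: "A.uniformizer F \<pi>"
    using number_field_uniformizer[OF A(1) F fin two_is_prime_nat A(2)] by auto
  obtain \<rho> where rho: "B.uniformizer F \<rho>"
    using number_field_uniformizer[OF B(1) F fin _ B(2)] by auto
  have pi': "\<pi> \<in> F" "\<pi> \<noteq> 0" and rho': "\<rho> \<in> F" "\<rho> \<noteq> 0"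
    using pi rho by (auto simp: A.uniformizer_def B.uniformizer_def)
  have A2: "2 \<in> A.max_ideal" and B3: "3 \<in> B.max_ideal"
    using A(2) B(2) by auto
  have F23: "2 \<in> F" "3 \<in> F"
    using subfield_setD(11)[OF F, of 2] subfield_setD(11)[OF F, of 3] by auto
  \<comment> \<open>Weak approximation by hand: above 2, a large power of 2 makes the term with
    \<open>\<rho>\<close> negligible while 3 is a unit; above 3 the roles are exchanged. One
    \<open>b\<close> thus has the value of \<open>\<pi>\<close> above 2 and that of
    \<open>\<rho>\<close> above 3.\<close>
  have "\<exists>N0. \<forall>N\<ge>N0. \<rho> / \<pi> * 2 ^ N \<in> A.max_ideal"
    by (rule A.absorb_power[OF pi F23(1) A2]) (use pi' rho' subfield_setD[OF F] in auto)
  moreover have "\<exists>N0. \<forall>N\<ge>N0. \<pi> / \<rho> * 3 ^ N \<in> B.max_ideal"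
    by (rule B.absorb_power[OF rho F23(2) B3]) (use pi' rho' subfield_setD[OF F] in auto)
  ultimately obtain N where N: "\<rho> / \<pi> * 2 ^ N \<in> A.max_ideal" "\<pi> / \<rho> * 3 ^ N \<in> B.max_ideal"
    by (metis max.cobounded1 max.cobounded2)
  define b where "b = \<pi> * 3 ^ N + \<rho> * 2 ^ N"
  have "b \<in> F"
    unfolding b_def by (intro subfield_setD[OF F] pi' rho' F23)
  have bA: "A.equiv_val b \<pi>"
  proof -
    have "A.equiv_val 3 1"
      using A.of_int_equiv_one[OF A(2), of 3] by simp
    hence "A.equiv_val (3 ^ N + \<rho> / \<pi> * 2 ^ N) 1"
      using A.equiv_power[of 3 1 N] N by (intro A.add_max_ideal_equiv) auto
    hence "A.equiv_val (\<pi> * (3 ^ N + \<rho> / \<pi> * 2 ^ N)) (\<pi> * 1)"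
      by (intro A.equiv_mult A.equiv_refl pi')
    thus ?thesis
      using pi' by (simp add: b_def distrib_left)
  qed
  have bB: "B.equiv_val b \<rho>"
  proof -
    have "B.equiv_val 2 1"
      using B.of_int_equiv_one[OF B(2), of 2] by simp
    hence "B.equiv_val (2 ^ N + \<pi> / \<rho> * 3 ^ N) 1"
      using B.equiv_power[of 2 1 N] N by (intro B.add_max_ideal_equiv) auto
    hence "B.equiv_val (\<rho> * (2 ^ N + \<pi> / \<rho> * 3 ^ N)) (\<rho> * 1)"
      by (intro B.equiv_mult B.equiv_refl rho')
    thus ?thesis
      using rho' by (simp add: b_def distrib_left add.commute)
  qed
  have bmax: "b \<in> B.max_ideal" "b \<noteq> 0"
    using B.equiv_max_ideal[OF bB] rho bB by (auto simp: B.uniformizer_def B.equiv_val_def)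
  define f where "f = (Polynomial.monom 4 (n - 1) + [:b:]) + Polynomial.monom 1 n"
  have "Polynomial.degree (Polynomial.monom 4 (n - 1) + [:b:]) < n"
    using n by (intro degree_add_less) (auto simp: degree_monom_eq)
  hence "Polynomial.lead_coeff f = 1"
    unfolding f_def using n by (subst lead_coeff_add_le) (auto simp: degree_monom_eq)
  moreover have "Polynomial.coeff f 0 = b"
    using n by (simp add: f_def)
  \<comment> \<open>The choice of the root matters above 3, where it has to avoid the root of value
    zero; above 2 all roots have the same value.\<close>
  ultimately obtain \<alpha> where \<alpha>: "\<alpha> \<in> B.max_ideal" "poly f \<alpha> = 0"
    using root_in_max_ideal[OF B(1), of f] bmax by auto
  have root: "\<alpha> ^ n + 4 * \<alpha> ^ (n - 1) + b = 0"
    using \<alpha>(2) by (simp add: f_def poly_monom add_ac)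
  have ordA: "A.equiv_val (\<alpha> ^ n) \<pi>"
    by (rule eisenstein_root[OF A(1) pi F A2 bA root n])
  have ordB: "B.equiv_val (\<alpha> ^ (n - 1)) \<rho>"
    using tame_root[OF B(1) B3 \<alpha>(1) root n bmax(2)] bB by (rule B.equiv_trans)
  have "\<alpha> \<noteq> 0"
    using root n bmax(2) by (auto simp: power_0_left)
  show ?thesis
  proof (rule exI[of _ \<alpha>], rule exI[of _ b], intro conjI allI impI)
    show "b \<in> F" "\<alpha> ^ n + 4 * \<alpha> ^ (n - 1) + b = 0"
      by fact+
    fix e assume "algebraic_le F e \<alpha>"
    then obtain s a where s: "1 \<le> s" "s \<le> e" "a \<in> F" "A.equiv_val (\<alpha> ^ s) a"
      using A.power_equiv_subfield[OF F _ \<open>\<alpha> \<noteq> 0\<close>] by blast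
    have "n dvd s"
      using A.dvd_of_power_equiv[OF pi ordA s(4,3)] .
    thus "n \<le> e"
      using s by (auto dest: dvd_imp_le)
  next
    fix M e m
    assume M: "subfield_set M" "algebraic_le M e \<alpha>" "\<forall>x\<in>M. algebraic_le F m x" "e * m = n"
    \<comment> \<open>Ramification is bounded in two stages, from \<open>\<alpha>\<close> down to
      \<open>M\<close> and from \<open>M\<close> down to \<open>F\<close>.\<close>
    obtain s a where s: "1 \<le> s" "s \<le> e" "a \<in> M" "B.equiv_val (\<alpha> ^ s) a"
      using B.power_equiv_subfield[OF M(1,2) \<open>\<alpha> \<noteq> 0\<close>] by blast
    have "a \<noteq> 0"
      using s(4) by (auto simp: B.equiv_val_def)
    then obtain t c where t: "1 \<le> t" "t \<le> m" "c \<in> F" "B.equiv_val (a ^ t) c"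
      using B.power_equiv_subfield[OF F bspec[OF M(3) s(3)]] by blast
    have "B.equiv_val (\<alpha> ^ (s * t)) c"
      unfolding power_mult using B.equiv_power[OF s(4)] t(4) by (rule B.equiv_trans)
    hence "n - 1 dvd s * t"
      using B.dvd_of_power_equiv[OF rho ordB _ t(3)] by blast
    thus "e = 1 \<or> m = 1"
      using intermediate_degrees_trivial M(4) s t by blast
  qed
qed

section \<open>Embedding number fields into the complex numbers\<close>

text \<open>Since \<open>h\<close> acts coefficientwise on lists, the result may have leading zeros;
  evaluation does not see them, so the identities are compared after
  \<open>normalize\<close>.\<close>

lemma ring_hom_eval_map:
  assumes "ring R" "cring S" and h: "h \<in> ring_hom R S" and z: "z \<in> carrier S"
  shows "(\<lambda>p. ring.eval S (map h p) z) \<in> ring_hom (poly_ring R) S"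
proof -
  interpret S: cring S by fact
  interpret H: ring_hom_ring R S h
    using ring_hom_ringI2[OF assms(1) S.ring_axioms h] .
  have carr: "set p \<subseteq> carrier R" if "p \<in> carrier (poly_ring R)" for p
    using that unfolding univ_poly_carrier[symmetric] polynomial_def by auto
  have carrS: "set (map h p) \<subseteq> carrier S" if "set p \<subseteq> carrier R" for p
    using that by auto
  show ?thesis
  proof (rule ring_hom_memI)
    fix p assume "p \<in> carrier (poly_ring R)"
    thus "S.eval (map h p) z \<in> carrier S"
      using S.eval_in_carrier[OF carrS[OF carr] z] by blast
  next
    fix p q assume pq: "p \<in> carrier (poly_ring R)" "q \<in> carrier (poly_ring R)"
    note c = carr[OF pq(1)] carr[OF pq(2)]
    have "S.eval (map h (H.R.poly_mult p q)) z = S.eval (S.normalize (map h (H.R.poly_mult p q))) z"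
      using S.eval_normalize[OF carrS z] H.R.poly_mult_in_carrier c by simp
    also have "\<dots> = S.eval (map h p) z \<otimes>\<^bsub>S\<^esub> S.eval (map h q) z"
      unfolding H.poly_mult_hom'[OF c] using S.eval_poly_mult carrS c z by blast
    finally show "S.eval (map h (p \<otimes>\<^bsub>poly_ring R\<^esub> q)) z = S.eval (map h p) z \<otimes>\<^bsub>S\<^esub> S.eval (map h q) z"
      unfolding univ_poly_mult .
    have "S.eval (map h (H.R.poly_add p q)) z = S.eval (S.normalize (map h (H.R.poly_add p q))) z"
      using S.eval_normalize[OF carrS z] H.R.poly_add_in_carrier c by simp
    also have "\<dots> = S.eval (map h p) z \<oplus>\<^bsub>S\<^esub> S.eval (map h q) z"
      unfolding H.poly_add_hom'[OF c] using S.eval_poly_add carrS c z by blast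
    finally show "S.eval (map h (p \<oplus>\<^bsub>poly_ring R\<^esub> q)) z = S.eval (map h p) z \<oplus>\<^bsub>S\<^esub> S.eval (map h q) z"
      unfolding univ_poly_add .
  next
    show "S.eval (map h \<one>\<^bsub>poly_ring R\<^esub>) z = \<one>\<^bsub>S\<^esub>"
      unfolding univ_poly_one using z by simp
  qed
qed

text \<open>The minimal polynomial of \<open>x\<close>, carried to \<open>S\<close>, has a root
  there, and \<open>x\<close> is sent to it. The assumption \<open>closed\<close> is algebraic
  closedness: a list of length at least 2 is a nonconstant polynomial.\<close>

lemma (in field) extend_hom_simple_extension:
  assumes "field S" and F: "subfield F R" and x: "x \<in> carrier R" "(algebraic over F) x"
    and h: "h \<in> ring_hom (R\<lparr>carrier := F\<rparr>) S"
    and closed: "\<And>q. q \<in> carrier (poly_ring S) \<Longrightarrow> length q \<ge> 2 \<Longrightarrow> \<exists>z\<in>carrier S. ring.eval S q z = \<zero>\<^bsub>S\<^esub>"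
  shows "\<exists>g. g \<in> ring_hom (R\<lparr>carrier := simple_extension F x\<rparr>) S"
proof -
  interpret S: field S by fact
  have fieldF: "field (R\<lparr>carrier := F\<rparr>)"
    using subfield_iff(2)[OF F] .
  have polyF: "poly_ring (R\<lparr>carrier := F\<rparr>) = (F[X])"
    using univ_poly_consistent[OF subfieldE(1)[OF F]] by simp
  interpret P: ring "F[X]"
    using univ_poly_is_ring[OF subfieldE(1)[OF F]] .
  interpret E: ring_hom_ring "F[X]" R "\<lambda>p. eval p x"
    using eval_ring_hom[OF subfieldE(1)[OF F] x(1)] .
  define p where "p = Irr F x"
  have p: "p \<in> carrier (F[X])" "eval p x = \<zero>" "pirreducible F p"
    using IrrE[OF F x] by (auto simp: p_def)
  have "length p \<ge> 2"
    using pirreducible_degree[OF F p(1,3)] by simp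
  moreover have "map h p \<in> carrier (poly_ring S)"
    using polynomial_hom[OF h fieldF S.field_axioms] p(1) polyF by simp
  ultimately obtain z where z: "z \<in> carrier S" "S.eval (map h p) z = \<zero>\<^bsub>S\<^esub>"
    using closed[of "map h p"] by auto
  define ev where "ev = (\<lambda>q. S.eval (map h q) z)"
  have "ev \<in> ring_hom (F[X]) S"
    unfolding ev_def polyF[symmetric]
    using ring_hom_eval_map[OF field.is_ring[OF fieldF] S.is_cring h z(1)] .
  then interpret ev: ring_hom_ring "F[X]" S ev
    by (rule ring_hom_ringI2[OF P.ring_axioms S.ring_axioms])
  \<comment> \<open>Polynomials with the same value at \<open>x\<close> differ by a multiple of the
    minimal polynomial, which evaluation at \<open>z\<close> annihilates.\<close>
  have well: "ev q = ev r" if q: "q \<in> carrier (F[X])" and r: "r \<in> carrier (F[X])" and eq: "eval q x = eval r x" for q r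
  proof -
    have d: "q \<ominus>\<^bsub>F[X]\<^esub> r \<in> carrier (F[X])" using q r by simp
    have "eval (q \<ominus>\<^bsub>F[X]\<^esub> r) x = eval q x \<ominus> eval r x"
      using q r by (simp add: a_minus_def)
    hence "eval (q \<ominus>\<^bsub>F[X]\<^esub> r) x = \<zero>"
      using eq E.hom_closed[OF r] by (simp add: r_right_minus_eq)
    hence "p pdivides (q \<ominus>\<^bsub>F[X]\<^esub> r)"
      unfolding p_def by (rule Irr_minimal[OF F x d])
    hence "p divides\<^bsub>F[X]\<^esub> (q \<ominus>\<^bsub>F[X]\<^esub> r)"
      using pdivides_iff_shell[OF F p(1) d] by simp
    then obtain s where s: "s \<in> carrier (F[X])" "q \<ominus>\<^bsub>F[X]\<^esub> r = p \<otimes>\<^bsub>F[X]\<^esub> s"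
      by (auto simp: factor_def)
    have "ev (q \<ominus>\<^bsub>F[X]\<^esub> r) = ev p \<otimes>\<^bsub>S\<^esub> ev s"
      unfolding s(2) using p(1) s(1) by simp
    also have "\<dots> = \<zero>\<^bsub>S\<^esub>"
      using z(2) ev.hom_closed[OF s(1)] by (simp add: ev_def)
    finally have "ev q \<ominus>\<^bsub>S\<^esub> ev r = \<zero>\<^bsub>S\<^esub>"
      using q r by (simp add: a_minus_def)
    thus ?thesis
      using q r by (simp add: S.r_right_minus_eq)
  qed
  have img: "simple_extension F x = (\<lambda>p. eval p x) ` carrier (F[X])"
    using simple_extension_as_eval_img[OF subfieldE(3)[OF F] x(1)] .
  define rep where "rep = inv_into (carrier (F[X])) (\<lambda>p. eval p x)"
  have rep: "rep y \<in> carrier (F[X])" "eval (rep y) x = y" if "y \<in> simple_extension F x" for y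
    using that unfolding img rep_def by (auto intro: inv_into_into f_inv_into_f[where f = "\<lambda>p. eval p x"])
  have closed': "subring (simple_extension F x) R"
    using simple_extension_is_subring[OF subfieldE(1)[OF F] x(1)] .
  have "(\<lambda>y. ev (rep y)) \<in> ring_hom (R\<lparr>carrier := simple_extension F x\<rparr>) S"
  proof (rule ring_hom_memI)
    fix y assume "y \<in> carrier (R\<lparr>carrier := simple_extension F x\<rparr>)"
    thus "ev (rep y) \<in> carrier S"
      using rep by simp
  next
    fix y w assume "y \<in> carrier (R\<lparr>carrier := simple_extension F x\<rparr>)" "w \<in> carrier (R\<lparr>carrier := simple_extension F x\<rparr>)"
    hence yw: "y \<in> simple_extension F x" "w \<in> simple_extension F x" by auto
    note r = rep[OF yw(1)] rep[OF yw(2)]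
    have "ev (rep (y \<otimes> w)) = ev (rep y \<otimes>\<^bsub>F[X]\<^esub> rep w)"
      using r rep[OF subringE(6)[OF closed' yw]] by (intro well) auto
    thus "ev (rep (y \<otimes>\<^bsub>R\<lparr>carrier := simple_extension F x\<rparr>\<^esub> w)) = ev (rep y) \<otimes>\<^bsub>S\<^esub> ev (rep w)"
      using r by simp
    have "ev (rep (y \<oplus> w)) = ev (rep y \<oplus>\<^bsub>F[X]\<^esub> rep w)"
      using r rep[OF subringE(7)[OF closed' yw]] by (intro well) auto
    thus "ev (rep (y \<oplus>\<^bsub>R\<lparr>carrier := simple_extension F x\<rparr>\<^esub> w)) = ev (rep y) \<oplus>\<^bsub>S\<^esub> ev (rep w)"
      using r by simp
  next
    have "ev (rep \<one>) = ev \<one>\<^bsub>F[X]\<^esub>"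
      using rep[OF subringE(3)[OF closed']] by (intro well) auto
    thus "ev (rep \<one>\<^bsub>R\<lparr>carrier := simple_extension F x\<rparr>\<^esub>) = \<one>\<^bsub>S\<^esub>"
      by simp
  qed
  thus ?thesis by blast
qed

text \<open>Generators are adjoined one at a time. The induction also carries that the extension is
  a subfield, as the next adjunction requires.\<close>

lemma (in field) extend_hom_finite_extension:
  assumes "field S" and F: "subfield F R" and h: "h \<in> ring_hom (R\<lparr>carrier := F\<rparr>) S"
    and closed: "\<And>q. q \<in> carrier (poly_ring S) \<Longrightarrow> length q \<ge> 2 \<Longrightarrow> \<exists>z\<in>carrier S. ring.eval S q z = \<zero>\<^bsub>S\<^esub>"
    and xs: "set xs \<subseteq> carrier R" "\<And>x. x \<in> set xs \<Longrightarrow> (algebraic over F) x"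
  shows "subfield (finite_extension F xs) R \<and> (\<exists>g. g \<in> ring_hom (R\<lparr>carrier := finite_extension F xs\<rparr>) S)"
  using xs
proof (induction xs)
  case Nil
  thus ?case using F h by auto
next
  case (Cons x xs)
  then obtain g where E: "subfield (finite_extension F xs) R"
    and g: "g \<in> ring_hom (R\<lparr>carrier := finite_extension F xs\<rparr>) S"
    by auto
  have x: "x \<in> carrier R" "(algebraic over F) x"
    using Cons.prems by auto
  have "F \<subseteq> finite_extension F xs"
    using finite_extension_incl[OF subfieldE(3)[OF F]] Cons.prems by auto
  hence alg: "(algebraic over (finite_extension F xs)) x"
    using algebraic_mono x(2) by blast
  show ?case
    using simple_extension_is_subfield[OF E x(1)] alg
      extend_hom_simple_extension[OF assms(1) E x(1) alg g closed] by simp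
qed

section \<open>The complex numbers as a ring with explicit carrier\<close>

abbreviation complex_ring :: "complex ring" where
  "complex_ring \<equiv> ring_of_type_algebra"

lemma field_complex_ring: "field complex_ring"
  by (rule field_from_type_algebra)

interpretation CC: domain complex_ring
  using field_complex_ring by (rule field.axioms)

lemma complex_ring_simps [simp]:
  "carrier complex_ring = UNIV" "x \<otimes>\<^bsub>complex_ring\<^esub> y = x * y" "x \<oplus>\<^bsub>complex_ring\<^esub> y = x + y"
  "\<one>\<^bsub>complex_ring\<^esub> = 1" "\<zero>\<^bsub>complex_ring\<^esub> = 0"
  by (auto simp: ring_of_type_algebra_def)

lemma complex_ring_pow [simp]: "x [^]\<^bsub>complex_ring\<^esub> (n::nat) = x ^ n"
  by (induction n) (auto simp: mult.commute)

text \<open>The two kinds of polynomials list their coefficients in opposite orders, hence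
  \<open>rev\<close>.\<close>

lemma complex_ring_eval: "CC.eval p x = poly (Poly (rev p)) x"
  by (induction p) (auto simp: Poly_append poly_monom)

lemma complex_ring_root:
  assumes "q \<in> carrier (poly_ring complex_ring)" "length q \<ge> 2"
  shows "\<exists>z\<in>carrier complex_ring. CC.eval q z = \<zero>\<^bsub>complex_ring\<^esub>"
proof -
  have "hd q \<noteq> 0"
    using assms unfolding univ_poly_carrier[symmetric] polynomial_def by auto
  moreover have "Polynomial.coeff (Poly (rev q)) (length q - 1) = hd q"
    using assms(2) by (cases q) (auto simp: nth_default_def nth_append)
  ultimately have "Polynomial.degree (Poly (rev q)) \<ge> length q - 1"
    by (intro le_degree) simp
  hence "\<not> constant (poly (Poly (rev q)))"
    using assms(2) by (simp add: constant_degree)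
  then obtain z where "poly (Poly (rev q)) z = 0"
    using fundamental_theorem_of_algebra by blast
  thus ?thesis
    by (auto simp: complex_ring_eval)
qed

text \<open>The copy of \<rat> inside \<open>K\<close> embeds into \<complex>, and this extends
  along a finite spanning list of algebraic elements.\<close>

lemma number_field_embedding:
  assumes "algebraic_number_field K"
  shows "\<exists>\<sigma>. \<sigma> \<in> ring_hom K complex_ring"
proof -
  interpret K: field K
    using assms by (simp add: algebraic_number_field_def)
  obtain h n where ext: "field_extension rat_ring K h" and "has_degree rat_ring K h n"
    using assms by (auto simp: algebraic_number_field_def)
  hence h: "h \<in> ring_hom rat_ring K" and rat: "field rat_ring" and dim: "K.dimension n (range h) (carrier K)"
    by (auto simp: field_extension_def has_degree_def)
  interpret rat: field rat_ring by fact
  interpret H: ring_hom_ring rat_ring K h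
    using ring_hom_ringI2[OF rat.ring_axioms K.ring_axioms h] .
  have sub: "subfield (range h) K" and inj: "inj h"
    using H.img_is_subfield[OF rat.carrier_is_subfield K.one_not_zero] by auto
  have hom: "h (a * b) = h a \<otimes>\<^bsub>K\<^esub> h b" "h (a + b) = h a \<oplus>\<^bsub>K\<^esub> h b" "h 1 = \<one>\<^bsub>K\<^esub>" for a b
    using H.hom_mult[of a b] H.hom_add[of a b] H.hom_one by auto
  have inv: "inv_into UNIV h (h a) = a" for a
    using inj by simp
  have "(\<lambda>y. of_rat (inv_into UNIV h y)) \<in> ring_hom (K\<lparr>carrier := range h\<rparr>) complex_ring"
    by (rule ring_hom_memI) (auto simp: inv of_rat_mult of_rat_add simp flip: hom)
  moreover obtain Us where Us: "set Us \<subseteq> carrier K" "K.Span (range h) Us = carrier K"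
    using K.exists_base[OF sub dim] by auto
  moreover have "(K.algebraic over range h) x" if "x \<in> set Us" for x
    using K.finite_dimension_imp_algebraic[OF sub K.carrier_is_subring K.finite_dimensionI[OF dim]] that Us(1) by auto
  ultimately have E: "subfield (K.finite_extension (range h) Us) K"
    and "\<exists>g. g \<in> ring_hom (K\<lparr>carrier := K.finite_extension (range h) Us\<rparr>) complex_ring"
    using K.extend_hom_finite_extension[OF field_complex_ring sub _ complex_ring_root, of _ Us] by blast+
  \<comment> \<open>The field generated by the spanning list is a subspace containing that list,
    hence all of \<open>K\<close>.\<close>
  moreover have "K.finite_extension (range h) Us = carrier K"
  proof
    show "K.finite_extension (range h) Us \<subseteq> carrier K"
      using subfieldE(3)[OF E] .
    have incl: "range h \<subseteq> K.finite_extension (range h) Us" "set Us \<subseteq> K.finite_extension (range h) Us"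
      using K.finite_extension_incl[OF subfieldE(3)[OF sub] Us(1)]
        K.finite_extension_mem[OF subfieldE(1)[OF sub] Us(1)] by auto
    note Ec = subringE[OF subfieldE(1)[OF E]]
    have "subalgebra (range h) (K.finite_extension (range h) Us) K"
      unfolding subalgebra_def subalgebra_axioms_def
      using subring.axioms(1)[OF subfieldE(1)[OF E]] Ec(6) incl(1) by blast
    hence "K.Span (range h) Us \<subseteq> K.finite_extension (range h) Us"
      using K.subalgebra_Span_incl[OF sub] incl(2) by blast
    thus "carrier K \<subseteq> K.finite_extension (range h) Us"
      unfolding Us(2) .
  qed
  ultimately show ?thesis by simp
qed

section \<open>Extensions of number fields without intermediate fields\<close>

lemma complex_ring_uminus [simp]: "\<ominus>\<^bsub>complex_ring\<^esub> x = - x"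
  using CC.minus_equality[of "-x" x] by simp

lemma complex_ring_subfield_set:
  assumes "subfield F complex_ring"
  shows "subfield_set F"
proof -
  note c = subringE[OF subfieldE(1)[OF assms]]
  have "inverse x \<in> F" if "x \<in> F" for x
  proof (cases "x = 0")
    case False
    let ?y = "inv\<^bsub>complex_ring\<^esub> x"
    have "?y \<in> F" "x * ?y = 1"
      using CC.subfield_m_inv[OF assms, of x] that False by auto
    moreover from this(2) have "?y = inverse x"
      using False by (simp add: inverse_unique)
    ultimately show ?thesis by simp
  qed (use that in simp)
  moreover have "x - y \<in> F" if "x \<in> F" "y \<in> F" for x y
    using c(7)[OF that(1) c(5)[OF that(2)]] by simp
  ultimately show ?thesis
    using c(3,6) by (auto simp: subfield_set_def)
qed

section \<open>From dimensions to algebraic relations\<close>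

lemma complex_ring_combine:
  "length Ks = length Us \<Longrightarrow> CC.combine Ks Us = (\<Sum>i<length Us. Ks ! i * Us ! i)"
  by (induction Ks Us rule: list_induct2) (simp_all add: sum.lessThan_Suc_shift del: sum.lessThan_Suc)

text \<open>The \<open>d + 1\<close> powers of \<open>x\<close> up to \<open>x ^ d\<close> are
  dependent in a space of dimension \<open>d\<close>.\<close>

lemma algebraic_le_dimension:
  assumes F: "subfield F complex_ring" and dim: "CC.dimension d F E"
    and E: "\<And>i. x ^ i \<in> E"
  shows "algebraic_le F d x"
proof -
  define Us where "Us = map (\<lambda>i. x ^ i) [0..<Suc d]"
  have "CC.dependent F Us"
    using CC.independent_length_le_dimension[OF F dim, of Us] E by (auto simp: Us_def)
  then obtain Ks where Ks: "length Ks = length Us" "CC.combine Ks Us = 0" "set Ks \<subseteq> F" "set Ks \<noteq> {0}"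
    using CC.dependent_imp_non_trivial_combine[OF F, of Us] by auto
  have len: "length Us = Suc d" by (simp add: Us_def)
  have "set Ks \<noteq> {}"
    using Ks(1) len by auto
  then obtain j where j: "j \<le> d" "Ks ! j \<noteq> 0"
    using Ks(1,4) len by (auto simp: in_set_conv_nth set_eq_iff less_Suc_eq_le)
  have "(\<Sum>i\<le>d. Ks ! i * x ^ i) = (\<Sum>i<length Us. Ks ! i * Us ! i)"
    unfolding len lessThan_Suc_atMost by (intro sum.cong) (auto simp: Us_def nth_append simp del: upt_Suc)
  also have "\<dots> = 0"
    using complex_ring_combine[OF Ks(1)] Ks(2) by simp
  finally have sum: "(\<Sum>i\<le>d. Ks ! i * x ^ i) = 0" .
  \<comment> \<open>Coefficients are required at all indices, so the list is continued by
    zero.\<close>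
  define c where "c = (\<lambda>i. if i \<le> d then Ks ! i else 0)"
  have "c i \<in> F" for i
    using Ks(1,3) len subringE(2)[OF subfieldE(1)[OF F]] by (auto simp: c_def less_Suc_eq_le)
  moreover have "(\<Sum>i\<le>d. c i * x ^ i) = 0"
    unfolding sum[symmetric] by (intro sum.cong) (auto simp: c_def)
  moreover have "c j \<noteq> 0"
    using j by (simp add: c_def)
  ultimately show ?thesis
    unfolding algebraic_le_def using j(1) by blast
qed

lemma algebraic_le_dimension_subring:
  assumes F: "subfield F complex_ring" and dim: "CC.dimension d F E" and E: "subring E complex_ring" "x \<in> E"
  shows "algebraic_le F d x"
proof (rule algebraic_le_dimension[OF F dim])
  fix i show "x ^ i \<in> E"
    by (induction i) (use subringE(3,6)[OF E(1)] E(2) in auto)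
qed

lemma simple_extension_without_intermediate:
  assumes F: "subfield F complex_ring"
    and fin: "\<And>x. x \<in> F \<Longrightarrow> algebraic_le \<rat> d x" and n: "n \<ge> 1"
  shows "\<exists>L. subfield L complex_ring \<and> F \<subseteq> L \<and> CC.dimension n F L \<and>
    (\<forall>M. subfield M complex_ring \<longrightarrow> F \<subseteq> M \<longrightarrow> M \<subseteq> L \<longrightarrow> M = F \<or> M = L)"
proof (cases "n = 1")
  case True
  \<comment> \<open>Degree one is realised by \<open>F\<close> itself; the construction with a root
    starts at \<open>n = 2\<close>.\<close>
  thus ?thesis
    using F CC.dimension_one[OF F] by (intro exI[of _ F]) auto
next
  case False
  hence n2: "n \<ge> 2" using n by simp
  obtain \<alpha> b where b: "b \<in> F" "\<alpha> ^ n + 4 * \<alpha> ^ (n - 1) + b = 0"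
    and degree_ge: "\<And>e. algebraic_le F e \<alpha> \<Longrightarrow> n \<le> e"
    and no_int: "\<And>M e m. subfield_set M \<Longrightarrow> algebraic_le M e \<alpha> \<Longrightarrow> \<forall>x\<in>M. algebraic_le F m x \<Longrightarrow>
       e * m = n \<Longrightarrow> e = 1 \<or> m = 1"
    using primitive_algebraic_number[OF complex_ring_subfield_set[OF F] fin n2] by metis
  define L where "L = CC.simple_extension F \<alpha>"
  \<comment> \<open>The \<open>n + 1\<close> coefficients are listed from the leading one
    downwards.\<close>
  define p where "p = 1 # 4 # replicate (n - 2) 0 @ [b]"
  have "4 \<in> F"
    using subfield_setD(11)[OF complex_ring_subfield_set[OF F], of 4] by simp
  hence p: "p \<in> carrier (F[X]\<^bsub>complex_ring\<^esub>)"
    unfolding univ_poly_carrier[symmetric] polynomial_def p_def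
    using b(1) subringE(2,3)[OF subfieldE(1)[OF F]] by auto
  have "CC.eval (replicate (n - 2) 0 @ [b]) \<alpha> = b"
    using CC.eval_replicate[of "[b]" \<alpha> "n - 2"] by simp
  hence "CC.eval p \<alpha> = \<alpha> ^ n + 4 * \<alpha> ^ (n - 1) + b"
    using n2 by (simp add: p_def numeral_2_eq_2 Suc_diff_Suc Suc_diff_le flip: power_Suc)
  hence root: "CC.eval p \<alpha> = 0"
    using b(2) by simp
  have alg: "(CC.algebraic over F) \<alpha>"
    using CC.algebraicI[OF p _ ] root by (simp add: p_def over_def)
  have L: "subfield L complex_ring" and FL: "F \<subseteq> L" "\<alpha> \<in> L"
    unfolding L_def
    using CC.simple_extension_is_subfield[OF F] alg CC.simple_extension_incl[of F \<alpha>]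
      CC.simple_extension_mem[OF subfieldE(1)[OF F]] by auto
  define e where "e = length (CC.Irr F \<alpha>) - 1"
  have dimL: "CC.dimension e F L"
    unfolding L_def e_def using CC.dimension_simple_extension[OF F _ alg] by simp
  \<comment> \<open>Divisibility bounds the degree of \<open>\<alpha>\<close> from above by
    \<open>n\<close>; the valuation argument in \<open>degree_ge\<close> bounds it from
    below.\<close>
  have "(CC.Irr F \<alpha>) pdivides\<^bsub>complex_ring\<^esub> p"
    using CC.Irr_minimal[OF F _ alg p] root by simp
  hence "length (CC.Irr F \<alpha>) - 1 \<le> length p - 1"
    using CC.pdivides_imp_degree_le[OF subfieldE(1)[OF F] CC.IrrE(1)[OF F _ alg] p] by (simp add: p_def)
  hence "e \<le> n"
    using n2 by (simp add: e_def p_def)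
  moreover have "n \<le> e"
    using degree_ge algebraic_le_dimension_subring[OF F dimL subfieldE(1)[OF L] FL(2)] by blast
  ultimately have dimL: "CC.dimension n F L"
    using dimL by simp
  have "M = F \<or> M = L" if M: "subfield M complex_ring" "F \<subseteq> M" "M \<subseteq> L" for M
  proof -
    have "subalgebra F M complex_ring"
      unfolding subalgebra_def subalgebra_axioms_def
      using subring.axioms(1)[OF subfieldE(1)[OF M(1)]] subringE(6)[OF subfieldE(1)[OF M(1)]] M(2) by blast
    then obtain m where m: "CC.dimension m F M"
      using CC.subspace_dimension[OF F dimL _ M(3)] by blast
    have algM: "(CC.algebraic over M) \<alpha>"
      using CC.algebraic_mono[OF M(2) alg] .
    define l where "l = length (CC.Irr M \<alpha>) - 1"
    \<comment> \<open>As \<open>\<alpha>\<close> generates \<open>L\<close> over \<open>M\<close>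
      too, its degree over \<open>M\<close> is [L : M], and the tower law gives
      \<open>l * m = n\<close>.\<close>
    have "CC.simple_extension M \<alpha> = L"
    proof
      show "CC.simple_extension M \<alpha> \<subseteq> L"
        using CC.simple_extension_subring_incl[OF subfieldE(1)[OF L] M(3) FL(2)] .
      show "L \<subseteq> CC.simple_extension M \<alpha>"
        unfolding L_def using CC.mono_simple_extension[OF M(2)] .
    qed
    hence l: "CC.dimension l M L"
      unfolding l_def using CC.dimension_simple_extension[OF M(1) _ algM] by simp
    have "CC.dimension (m * l) F L"
      using CC.telescopic_base[OF F M(1) m l] .
    hence "l * m = n"
      using CC.dimension_is_inj[OF F dimL] by (simp add: mult.commute)
    moreover have "algebraic_le M l \<alpha>"
      using algebraic_le_dimension_subring[OF M(1) l subfieldE(1)[OF L] FL(2)] .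
    moreover have "algebraic_le F m x" if "x \<in> M" for x
      using algebraic_le_dimension_subring[OF F m subfieldE(1)[OF M(1)] that] .
    ultimately have "l = 1 \<or> m = 1"
      using no_int[OF complex_ring_subfield_set[OF M(1)]] by blast
    thus ?thesis
    proof
      assume "l = 1"
      thus ?thesis
        using CC.dimension_eq_imp_eq[OF M(1) CC.dimension_one[OF M(1)] _ M(3)] l by simp
    next
      assume "m = 1"
      thus ?thesis
        using CC.dimension_eq_imp_eq[OF F CC.dimension_one[OF F] _ M(2)] m by simp
    qed
  qed
  thus ?thesis
    using L FL(1) dimL by blast
qed

section \<open>Transport to an abstract number field\<close>

text \<open>A ring homomorphism fixes the integers and therefore their quotients.\<close>

lemma ring_hom_rat_ring_in_Rats:
  fixes g :: "rat \<Rightarrow> complex"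
  assumes "g \<in> ring_hom rat_ring complex_ring"
  shows "g x \<in> \<rat>"
proof -
  have g: "g (a * b) = g a * g b" "g (a + b) = g a + g b" "g 1 = 1" for a b
    using ring_hom_memE[OF assms] by auto
  have "g 0 = 0"
    using g(2)[of 0 0] by simp
  hence neg: "g (- a) = - g a" for a
    using g(2)[of a "-a"] by (simp add: eq_neg_iff_add_eq_0 add.commute)
  have int: "g (of_int k) = of_int k" for k
  proof (induction k rule: int_induct[where k = 0])
    case (step1 i)
    thus ?case by (simp add: g)
  next
    case (step2 i)
    thus ?case using g(2)[of "of_int i" "-1"] by (simp add: neg g(3))
  qed (simp add: \<open>g 0 = 0\<close>)
  obtain a b where ab: "x = of_int a / of_int b" "b > 0"
    by (cases x) (auto simp: Fract_of_int_quotient)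
  hence "x * of_int b = of_int a" by simp
  hence "g x * of_int b = of_int a"
    using g(1)[of x "of_int b"] int by metis
  hence "g x = of_int a / of_int b"
    using ab(2) by (simp add: field_simps)
  thus ?thesis by simp
qed

text \<open>The extension found inside \<complex> is copied to the prescribed type, and its
  intermediate fields are compared along the copying map \<open>\<phi>\<close>.\<close>

lemma maximal_linear_matching_property_of_subfield:
  fixes K :: "('a, 'm) ring_scheme"
  assumes K: "field K" and \<sigma>: "\<sigma> \<in> ring_hom K complex_ring"
    and fin: "\<And>x. x \<in> \<sigma> ` carrier K \<Longrightarrow> algebraic_le \<rat> d x" and n: "n \<ge> 1"
  shows "\<exists>(L :: 'a list set ring) h. field_extension K L h \<and> has_degree K L h n \<and>
    ring.linear_matching_property L (h ` carrier K)"
proof -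
  interpret K: field K by fact
  interpret \<sigma>: ring_hom_ring K complex_ring \<sigma>
    using ring_hom_ringI2[OF K.ring_axioms CC.ring_axioms \<sigma>] .
  define F where "F = \<sigma> ` carrier K"
  have F: "subfield F complex_ring" and inj: "inj_on \<sigma> (carrier K)"
    using \<sigma>.img_is_subfield[OF K.carrier_is_subfield CC.one_not_zero] by (auto simp: F_def)
  obtain L where L: "subfield L complex_ring" "F \<subseteq> L" "CC.dimension n F L"
    and no_int: "\<And>M. subfield M complex_ring \<Longrightarrow> F \<subseteq> M \<Longrightarrow> M \<subseteq> L \<Longrightarrow> M = F \<or> M = L"
    using simple_extension_without_intermediate[OF F fin n] unfolding F_def by metis
  let ?CL = "complex_ring\<lparr>carrier := L\<rparr>"
  interpret CL: field ?CL
    using CC.subfield_iff(2)[OF L(1)] .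

  obtain Us where Us: "CC.Span F Us = L" "set Us \<subseteq> carrier complex_ring"
    using CC.exists_base[OF F L(3)] by auto
  \<comment> \<open>Any choice of coefficients over a spanning list works: an element is recovered
    from its coefficients, which makes \<open>\<phi>\<close> injective.\<close>
  define coords where "coords = (\<lambda>y. SOME Ks. set Ks \<subseteq> F \<and> y = CC.combine Ks Us)"
  have coords: "set (coords y) \<subseteq> F \<and> y = CC.combine (coords y) Us" if "y \<in> L" for y
  proof -
    have "\<exists>Ks. set Ks \<subseteq> F \<and> y = CC.combine Ks Us"
      using that CC.Span_eq_combine_set[OF F Us(2)] Us(1) by auto
    thus ?thesis
      unfolding coords_def by (rule someI_ex)
  qed
  \<comment> \<open>Inverting \<open>\<sigma>\<close> turns coefficients in \<open>F\<close> into
    elements of \<open>K\<close>; the singleton yields the type \<open>'a list set\<close>.\<close>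
  define \<phi> where "\<phi> = (\<lambda>y. {map (inv_into (carrier K) \<sigma>) (coords y)})"
  have inj_\<phi>: "inj_on \<phi> L"
  proof (rule inj_onI)
    fix x y assume xy: "x \<in> L" "y \<in> L" "\<phi> x = \<phi> y"
    have "inj_on (inv_into (carrier K) \<sigma>) (set (coords x) \<union> set (coords y))"
      using coords[OF xy(1)] coords[OF xy(2)] unfolding F_def by (intro inj_on_inv_into) auto
    hence "coords x = coords y"
      using xy(3) unfolding \<phi>_def by (auto dest: map_inj_on)
    thus "x = y"
      using coords xy(1,2) by metis
  qed

  define L' where "L' = image_ring \<phi> ?CL"
  interpret L': field L'
    unfolding L'_def using CL.inj_imp_image_ring_is_field inj_\<phi> by simp
  have carrL': "carrier L' = \<phi> ` L"
    by (simp add: L'_def image_ring_carrier)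
  have iso: "\<phi> \<in> ring_iso ?CL L'"
    unfolding L'_def using inj_\<phi> by (intro inj_imp_image_ring_iso) simp
  hence \<phi>: "\<phi> \<in> ring_hom ?CL L'"
    by (simp add: ring_iso_def)
  interpret \<phi>: ring_hom_ring ?CL L' \<phi>
    using ring_hom_ringI2[OF CL.ring_axioms L'.ring_axioms \<phi>] .
  have FCL: "subfield F ?CL"
    using CL.subfield_iff(1)[of F] CC.subfield_iff(2)[OF F] L(2) by simp
  define h where "h = \<phi> \<circ> \<sigma>"
  have hK: "h ` carrier K = \<phi> ` F"
    by (simp add: h_def F_def image_comp)
  have subK: "subfield (\<phi> ` F) L'"
    using \<phi>.img_is_subfield(2)[OF FCL L'.one_not_zero] .
  have dim: "L'.dimension n (\<phi> ` F) (carrier L')"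
    unfolding carrL'
    using \<phi>.inj_hom_dimension[OF FCL L'.one_not_zero inj_\<phi>]
      CC.dimension_consistent[OF subfieldE(1)[OF L(1)] F L(2,3)] by simp

  have "field_extension K L' h"
    unfolding field_extension_def
  proof (intro conjI ballI)
    show "field K" by (rule K)
    show "division_ring L'"
      by unfold_locales (use L'.field_Units in auto)
    have "\<sigma> \<in> ring_hom K ?CL"
      using \<sigma> L(2) unfolding F_def ring_hom_def by auto
    thus h: "h \<in> ring_hom K L'"
      unfolding h_def using \<phi> by (rule ring_hom_trans)
    show "h k \<otimes>\<^bsub>L'\<^esub> x = x \<otimes>\<^bsub>L'\<^esub> h k" if "k \<in> carrier K" "x \<in> carrier L'" for k x
      using L'.m_comm ring_hom_memE(1)[OF h] that by blast
  qed
  moreover have "has_degree K L' h n"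
    using dim by (simp add: has_degree_def hK)
  moreover have "L'.linear_matching_property (h ` carrier K)"
    unfolding hK
  proof (rule L'.linear_matching_property_if_no_intermediate_field[OF subK _ L'.finite_dimensionI[OF dim]])
    fix M assume M: "subfield M L'" "\<phi> ` F \<subseteq> M"
    \<comment> \<open>An intermediate field of the copy is pulled back into \<complex>, where
      \<open>no_int\<close> applies.\<close>
    define \<psi> where "\<psi> = inv_into L \<phi>"
    have \<psi>\<phi>: "\<psi> (\<phi> y) = y" if "y \<in> L" for y
      unfolding \<psi>_def using inj_\<phi> that by simp
    have \<phi>\<psi>: "\<phi> ` \<psi> ` M = M"
      unfolding \<psi>_def using subfieldE(3)[OF M(1)] carrL' by (intro image_inv_into_cancel) simp_all
    have "ring_hom_ring (L'\<lparr>carrier := \<phi> ` L\<rparr>) ?CL (inv_into L \<phi>)"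
      using \<phi>.inv_ring_hom[of L] inj_\<phi> CL.carrier_is_subring by simp
    hence "\<psi> \<in> ring_hom (L'\<lparr>carrier := \<phi> ` L\<rparr>) ?CL"
      unfolding \<psi>_def by (rule ring_hom_ring.homh)
    hence "\<psi> \<in> ring_hom L' complex_ring"
      unfolding ring_hom_def carrL' by auto
    then interpret \<psi>: ring_hom_ring L' complex_ring \<psi>
      by (rule ring_hom_ringI2[OF L'.ring_axioms CC.ring_axioms])
    have "subfield (\<psi> ` M) complex_ring"
      using \<psi>.img_is_subfield(2)[OF M(1) CC.one_not_zero] .
    moreover have "F \<subseteq> \<psi> ` M"
    proof
      fix y assume "y \<in> F"
      hence "\<psi> (\<phi> y) \<in> \<psi> ` M" "\<psi> (\<phi> y) = y"
        using M(2) L(2) \<psi>\<phi> by auto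
      thus "y \<in> \<psi> ` M" by simp
    qed
    moreover have "\<psi> ` M \<subseteq> L"
      using subfieldE(3)[OF M(1)] carrL' \<psi>\<phi> by auto
    ultimately have "\<psi> ` M = F \<or> \<psi> ` M = L"
      by (rule no_int)
    thus "M = \<phi> ` F \<or> M = carrier L'"
      using \<phi>\<psi> carrL' by metis
  qed
  ultimately show ?thesis by blast
qed

theorem theorem2p4:
  fixes K :: "('a, 'm) ring_scheme"
  assumes "algebraic_number_field K"
  shows "maximal_linear_matching_property K"
  unfolding maximal_linear_matching_property_def
proof (intro allI impI)
  fix n :: nat assume n: "1 \<le> n"
  interpret K: field K
    using assms by (simp add: algebraic_number_field_def)
  obtain \<sigma> where \<sigma>: "\<sigma> \<in> ring_hom K complex_ring"
    using number_field_embedding[OF assms] by blast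
  interpret \<sigma>: ring_hom_ring K complex_ring \<sigma>
    using ring_hom_ringI2[OF K.ring_axioms CC.ring_axioms \<sigma>] .
  obtain h d where ext: "field_extension rat_ring K h" and "has_degree rat_ring K h d"
    using assms by (auto simp: algebraic_number_field_def)
  hence h: "h \<in> ring_hom rat_ring K" and rat: "field rat_ring" and dim: "K.dimension d (range h) (carrier K)"
    by (auto simp: field_extension_def has_degree_def)
  interpret rat: field rat_ring by fact
  interpret H: ring_hom_ring rat_ring K h
    using ring_hom_ringI2[OF rat.ring_axioms K.ring_axioms h] .
  have sub: "subfield (range h) K"
    using H.img_is_subfield[OF rat.carrier_is_subfield K.one_not_zero] by auto
  have inj: "inj_on \<sigma> (carrier K)" and img: "subfield (\<sigma> ` carrier K) complex_ring"
    using \<sigma>.img_is_subfield[OF K.carrier_is_subfield CC.one_not_zero] by auto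
  have Q: "subfield (\<sigma> ` range h) complex_ring"
    using \<sigma>.img_is_subfield(2)[OF sub CC.one_not_zero] .
  have "\<sigma> \<circ> h \<in> ring_hom rat_ring complex_ring"
    using ring_hom_trans[OF h \<sigma>] .
  hence rats: "\<sigma> ` range h \<subseteq> \<rat>"
    using ring_hom_rat_ring_in_Rats[of "\<sigma> \<circ> h"] by auto
  have dim': "CC.dimension d (\<sigma> ` range h) (\<sigma> ` carrier K)"
    using \<sigma>.inj_hom_dimension[OF sub CC.one_not_zero inj dim] .
  \<comment> \<open>The relation has coefficients in the image of \<rat> under
    \<open>\<sigma> \<circ> h\<close>, and this image lies in \<rat>.\<close>
  have "algebraic_le \<rat> d x" if "x \<in> \<sigma> ` carrier K" for x
    using algebraic_le_dimension_subring[OF Q dim' subfieldE(1)[OF img] that] rats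
    unfolding algebraic_le_def by blast
  thus "\<exists>(L :: 'a list set ring) h. field_extension K L h \<and> has_degree K L h n \<and>
      ring.linear_matching_property L (h ` carrier K)"
    using maximal_linear_matching_property_of_subfield[OF K.field_axioms \<sigma> _ n] by blast
qed

end
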